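(* For each $n\in\mathbb{N}$ let $\mathcal{A}_n$ be a unital $*$-algebra with a distinguished state $\phi_n$ and conditions $\psi_{n,1},\dots,\psi_{n,n}$, let $(\phi_{i,j}(n))_{1\le i,j\le n}$ be the array of states $\phi_{j,j}(n)=\phi_n$ and $\phi_{i,j}(n)=\psi_{n,j}$ for $i\neq j$, and let $(X_{i,j}(n))_{1\le i,j\le n}$ be an array of self-adjoint elements of $\mathcal{A}_n$. Assume that (1) for each $n$ the array $(X_{i,j}(n))$ is matricially free with respect to $(\phi_{i,j}(n))$; (2) $\phi_{i,j}(n)(X_{i,j}(n))=0$ and $\phi_{i,j}(n)(X_{i,j}^2(n))=v_{i,j}(n)$ for all $n$ and $i,j\in[n]$; (3) the moments of the $X_{i,j}(n)$ are uniformly bounded with respect to $(\phi_{i,j}(n))$; (4) for each $n$ the variance matrix $V(n)=(v_{i,j}(n))$ is of block form determined by a dimension matrix $D=\mathrm{diag}(d_1,\dots,d_r)$ and a matrix $U=(u_{i,j})\in M_r(\mathbb{R})$. Let $S(n)=\sum_{i,j=1}^n X_{i,j}(n)$. Then for every $m\in\mathbb{N}$ $$\lim_{n\to\infty}\phi_n(S^m(n))=\sum_{\pi\in\mathcal{NC}_m^2} b_0(\pi),$$ where $\pi\mapsto b_0(\pi)$ is the real-valued function $v_0$ defined in the context for the matrix $V=B=DU$.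
   Context: Notation: $[n]=\{1,\dots,n\}$; $(i_1,j_1)\ne\dots\ne(i_n,j_n)$ means that consecutive pairs differ. A state on a unital $*$-algebra is a normalized positive linear functional. Matricial freeness. Let $\Lambda=\bigcup_{n\ge1}\Lambda_n$, where $\Lambda_n=\{((i_1,i_2),(i_2,i_3),\dots,(i_n,i_n)):(i_1,i_2)\ne(i_2,i_3)\ne\dots\ne(i_n,i_n)\}$. Let $\mathcal{A}$ be a unital $*$-algebra, $(\mathcal{A}_{i,j})_{i,j\in I}$ an array of (not necessarily unital) $*$-subalgebras, each with an internal unit $1_{i,j}$ which is a projection, such that the subalgebra $\mathcal{I}$ generated by all $1_{i,j}$ is commutative. Let $\varphi$ be a distinguished state with $\varphi(1_{i,j})=\delta_{i,j}$ and let $\varphi_j$ ($j\in I$) be states, called conditions, with $\varphi_j(1_{i,k})=\delta_{j,k}$ for all $i,j,k$. Put $\varphi_{j,j}=\varphi$ and $\varphi_{i,j}=\varphi_j$ for $i\ne j$. The array $(\mathcal{A}_{i,j})$ is matricially free with respect to $(\varphi_{i,j})$ if: (a) $\varphi(a_1\cdots a_n)=0$ whenever $a_k\in\mathcal{A}_{i_k,j_k}\cap\ker\varphi_{i_k,j_k}$ for $k\in[n]$ and $(i_1,j_1)\ne\dots\ne(i_n,j_n)$; (b) $(1_{i,j})$ is a matricially free array of units: $\varphi(u_1au_2)=\varphi(u_1)\varphi(a)\varphi(u_2)$ for $a\in\mathcal{A}$, $u_1,u_2\in\mathcal{I}$, and, if $a\in\mathcal A$, $a_k\in\mathcal{A}_{i_k,j_k}\cap\ker\varphi_{i_k,j_k}$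 for $r<k\le n$, $r<n$ and $(i_r,j_r)\ne\dots\ne(i_n,j_n)$, then $\varphi(a1_{i_r,j_r}a_{r+1}\cdots a_n)$ equals $\varphi(aa_{r+1}\cdots a_n)$ if $((i_r,j_r),\dots,(i_n,j_n))\in\Lambda$ and $0$ otherwise. An array of self-adjoint variables $(a_{i,j})$ in $\mathcal{A}$ is matricially free with respect to $(\varphi_{i,j})$ if there are projections $1_{i,j}\in\mathcal{A}$ such that the array of algebras $(\mathbb{C}[a_{i,j},1_{i,j}])$, with $1_{i,j}$ the internal unit, is matricially free with respect to $(\varphi_{i,j})$. Uniform boundedness: for every $m\in\mathbb{N}$ there is $M_m\ge0$ with $|\phi_{i,j}(n)(X_{i,j}^m(n))|\le M_m n^{-m/2}$ for all $n$ and $i,j\in[n]$. Block form. $d_1,\dots,d_r>0$ with $\sum_k d_k=1$; $U=(u_{i,j})$ has $u_{j,j}>0$ and $u_{i,j}\ge0$ for $i\neq j$. For each $n$ let $n_k=\lfloor (d_1+\dots+d_k)n\rfloor-\lfloor (d_1+\dots+d_{k-1})n\rfloor$ and split $[n]=N_1\cup\dots\cup N_r$ into consecutive intervals with $|N_k|=n_k$. Block form means $v_{p,q}(n)=u_{i,j}/n$ whenever $p\in N_i$, $q\in N_j$. Partitions. $\mathcal{NC}_m^2$ is the set of non-crossing pair partitions of $[m]$ (empty for $m$ odd); $\mathcal{NC}^2=\bigcup_m\mathcal{NC}_m^2$. A non-crossing pair partition of an interval is covered if the smallest and largest elements of the interval lie in the same block. Every $\pi\in\mathcal{NC}^2$ decomposes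 uniquely as $\pi=\pi^{(1)}\cup\dots\cup\pi^{(p)}$ (D1), where the $\pi^{(i)}$ are covered partitions of consecutive intervals with union $[m]$. A covered $\pi$ with more than one block decomposes as $\pi=\pi^{(0)}\cup\pi^{(1)}\cup\dots\cup\pi^{(r)}$ (D2), where $\pi^{(0)}=\{1,m\}$ and $\pi^{(1)},\dots,\pi^{(r)}$ are covered partitions of consecutive intervals with union $\{2,\dots,m-1\}$. Partitions of intervals are identified with partitions of $[k]$ by relabelling. The function $v_0$. For a real square matrix $V=(v_{i,j})$ of size $s$ let $\tau(V)=\mathrm{diag}(\sum_j v_{j,1},\dots,\sum_j v_{j,s})$ and $V_0=\mathrm{diag}(v_{1,1},\dots,v_{s,s})$. Define diagonal matrices $V(\pi)$, $\pi\in\mathcal{NC}^2$, by: $V(\pi)=\tau(V)$ if $\pi$ is one block; $V(\pi)=\tau(V(\pi^{(1)})\cdots V(\pi^{(r)})V)$ if $\pi$ is covered with more than one block, by (D2); $V(\pi)=V(\pi^{(1)})\cdots V(\pi^{(p)})$ in general, by (D1). For covered $\pi$ define $V_0(\pi)=V_0$ if $\pi$ is one block and $V_0(\pi)=\tau(V(\pi^{(1)})\cdots V(\pi^{(r)})V_0)$ otherwise, by (D2). Put $v_0(\pi)=\mathrm{Tr}(V_0(\pi))$ for covered $\pi$ ($\mathrm{Tr}$ the unnormalized trace) and $v_0(\pi)=v_0(\pi^{(1)})\cdots v_0(\pi^{(p)})$ for general $\pi\in\mathcal{NC}^2$, by (D1). *)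

theory Defs
  imports
    "HOL-Analysis.Analysis"
    "HOL-Library.Disjoint_Sets"
    "Jordan_Normal_Form.VS_Connect"
begin

section \<open>Unital star-algebras and states\<close>

text \<open>
  The algebras of the sequence in the limit theorem may all be different, so they are records with
  explicit carriers; as their common element type is arbitrary, this is no restriction.
\<close>

record 'a star_algebra = "(complex, 'a) module" +
  star :: "'a \<Rightarrow> 'a"

locale unital_star_algebra =
  Module.module "class_ring :: complex ring" A + Ring.ring A
  for A :: "'a star_algebra" (structure) +
  assumes smult_mult_left:
      "x \<in> carrier A \<Longrightarrow> y \<in> carrier A \<Longrightarrow> (c \<odot>\<^bsub>A\<^esub> x) \<otimes>\<^bsub>A\<^esub> y = c \<odot>\<^bsub>A\<^esub> (x \<otimes>\<^bsub>A\<^esub> y)"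
    and smult_mult_right:
      "x \<in> carrier A \<Longrightarrow> y \<in> carrier A \<Longrightarrow> x \<otimes>\<^bsub>A\<^esub> (c \<odot>\<^bsub>A\<^esub> y) = c \<odot>\<^bsub>A\<^esub> (x \<otimes>\<^bsub>A\<^esub> y)"
    and star_closed: "x \<in> carrier A \<Longrightarrow> star A x \<in> carrier A"
    and star_star: "x \<in> carrier A \<Longrightarrow> star A (star A x) = x"
    and star_add:
      "x \<in> carrier A \<Longrightarrow> y \<in> carrier A \<Longrightarrow> star A (x \<oplus>\<^bsub>A\<^esub> y) = star A x \<oplus>\<^bsub>A\<^esub> star A y"
    and star_smult: "x \<in> carrier A \<Longrightarrow> star A (c \<odot>\<^bsub>A\<^esub> x) = cnj c \<odot>\<^bsub>A\<^esub> star A x"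
    and star_mult:
      "x \<in> carrier A \<Longrightarrow> y \<in> carrier A \<Longrightarrow> star A (x \<otimes>\<^bsub>A\<^esub> y) = star A y \<otimes>\<^bsub>A\<^esub> star A x"

definition self_adjoint :: "'a star_algebra \<Rightarrow> 'a \<Rightarrow> bool" where
  "self_adjoint A x \<longleftrightarrow> x \<in> carrier A \<and> star A x = x"

definition projection :: "'a star_algebra \<Rightarrow> 'a \<Rightarrow> bool" where
  "projection A p \<longleftrightarrow> self_adjoint A p \<and> p \<otimes>\<^bsub>A\<^esub> p = p"

definition state :: "'a star_algebra \<Rightarrow> ('a \<Rightarrow> complex) \<Rightarrow> bool" where
  "state A f \<longleftrightarrow>
     (\<forall>x\<in>carrier A. \<forall>y\<in>carrier A. f (x \<oplus>\<^bsub>A\<^esub> y) = f x + f y) \<and>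
     (\<forall>c. \<forall>x\<in>carrier A. f (c \<odot>\<^bsub>A\<^esub> x) = c * f x) \<and>
     (\<forall>x\<in>carrier A. f (star A x \<otimes>\<^bsub>A\<^esub> x) \<in> \<real>\<^sub>\<ge>\<^sub>0) \<and>
     f \<one>\<^bsub>A\<^esub> = 1"

text \<open>Subalgebras need not contain the unit of the ambient algebra.\<close>

definition nonunital_subalgebra :: "'a star_algebra \<Rightarrow> 'a set \<Rightarrow> bool" where
  "nonunital_subalgebra A B \<longleftrightarrow>
     Module.submodule B (class_ring :: complex ring) A \<and> (\<forall>x\<in>B. \<forall>y\<in>B. x \<otimes>\<^bsub>A\<^esub> y \<in> B)"

definition star_subalgebra :: "'a star_algebra \<Rightarrow> 'a set \<Rightarrow> bool" where
  "star_subalgebra A B \<longleftrightarrow> nonunital_subalgebra A B \<and> (\<forall>x\<in>B. star A x \<in> B)"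

definition internal_unit :: "'a star_algebra \<Rightarrow> 'a set \<Rightarrow> 'a \<Rightarrow> bool" where
  "internal_unit A B e \<longleftrightarrow>
     e \<in> B \<and> projection A e \<and> (\<forall>x\<in>B. e \<otimes>\<^bsub>A\<^esub> x = x \<and> x \<otimes>\<^bsub>A\<^esub> e = x)"

definition list_product :: "'a star_algebra \<Rightarrow> 'a list \<Rightarrow> 'a" where
  "list_product A xs = foldr (\<otimes>\<^bsub>A\<^esub>) xs \<one>\<^bsub>A\<^esub>"


section \<open>Matricial freeness\<close>

text \<open>The sequences \<open>((i\<^sub>1,i\<^sub>2), (i\<^sub>2,i\<^sub>3), \<dots>, (i\<^sub>n,i\<^sub>n))\<close> in which consecutive pairs differ.\<close>

definition matricial_words :: "('i \<times> 'i) list set" where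
  "matricial_words = {zip is (tl is @ [last is]) | is. is \<noteq> [] \<and> distinct_adj (zip is (tl is @ [last is]))}"

definition state_array :: "('a \<Rightarrow> complex) \<Rightarrow> ('i \<Rightarrow> 'a \<Rightarrow> complex) \<Rightarrow> 'i \<Rightarrow> 'i \<Rightarrow> 'a \<Rightarrow> complex" where
  "state_array \<phi> \<psi> i j = (if i = j then \<phi> else \<psi> j)"

text \<open>\<open>a\<^sub>k \<in> \<A>\<^bsub>p\<^sub>k\<^esub> \<inter> ker \<phi>\<^bsub>p\<^sub>k\<^esub>\<close> for all \<open>k\<close>, where the indices \<open>p\<^sub>k\<close> are pairs from \<open>I \<times> I\<close>.\<close>

definition kernel_sequence ::
  "'i set \<Rightarrow> ('a \<Rightarrow> complex) \<Rightarrow> ('i \<Rightarrow> 'a \<Rightarrow> complex) \<Rightarrow> ('i \<Rightarrow> 'i \<Rightarrow> 'a set) \<Rightarrow>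
     ('i \<times> 'i) list \<Rightarrow> 'a list \<Rightarrow> bool" where
  "kernel_sequence I \<phi> \<psi> \<A> ps as \<longleftrightarrow>
     set ps \<subseteq> I \<times> I \<and>
     list_all2 (\<lambda>(i, j) a. a \<in> \<A> i j \<and> state_array \<phi> \<psi> i j a = 0) ps as"

definition unit_algebra :: "'a star_algebra \<Rightarrow> 'i set \<Rightarrow> ('i \<Rightarrow> 'i \<Rightarrow> 'a) \<Rightarrow> 'a set" where
  "unit_algebra A I e = nonunital_subalgebra A hull {e i j | i j. i \<in> I \<and> j \<in> I}"

definition algebra_array ::
  "'a star_algebra \<Rightarrow> 'i set \<Rightarrow> ('a \<Rightarrow> complex) \<Rightarrow> ('i \<Rightarrow> 'a \<Rightarrow> complex) \<Rightarrow>
     ('i \<Rightarrow> 'i \<Rightarrow> 'a set) \<Rightarrow> ('i \<Rightarrow> 'i \<Rightarrow> 'a) \<Rightarrow> bool" where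
  "algebra_array A I \<phi> \<psi> \<A> e \<longleftrightarrow>
     (\<forall>i\<in>I. \<forall>j\<in>I. star_subalgebra A (\<A> i j) \<and> internal_unit A (\<A> i j) (e i j)) \<and>
     (\<forall>u\<in>unit_algebra A I e. \<forall>w\<in>unit_algebra A I e. u \<otimes>\<^bsub>A\<^esub> w = w \<otimes>\<^bsub>A\<^esub> u) \<and>
     state A \<phi> \<and> (\<forall>i\<in>I. \<forall>j\<in>I. \<phi> (e i j) = (if i = j then 1 else 0)) \<and>
     (\<forall>j\<in>I. state A (\<psi> j) \<and> (\<forall>i\<in>I. \<forall>k\<in>I. \<psi> j (e i k) = (if j = k then 1 else 0)))"

definition matricially_free_units ::
  "'a star_algebra \<Rightarrow> 'i set \<Rightarrow> ('a \<Rightarrow> complex) \<Rightarrow> ('i \<Rightarrow> 'a \<Rightarrow> complex) \<Rightarrow>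
     ('i \<Rightarrow> 'i \<Rightarrow> 'a set) \<Rightarrow> ('i \<Rightarrow> 'i \<Rightarrow> 'a) \<Rightarrow> bool" where
  "matricially_free_units A I \<phi> \<psi> \<A> e \<longleftrightarrow>
     (\<forall>a\<in>carrier A. \<forall>u\<in>unit_algebra A I e. \<forall>w\<in>unit_algebra A I e.
        \<phi> (u \<otimes>\<^bsub>A\<^esub> a \<otimes>\<^bsub>A\<^esub> w) = \<phi> u * \<phi> a * \<phi> w) \<and>
     (\<forall>a\<in>carrier A. \<forall>i\<in>I. \<forall>j\<in>I. \<forall>ps as.
        ps \<noteq> [] \<and> kernel_sequence I \<phi> \<psi> \<A> ps as \<and> distinct_adj ((i, j) # ps) \<longrightarrow>
        \<phi> (a \<otimes>\<^bsub>A\<^esub> e i j \<otimes>\<^bsub>A\<^esub> list_product A as) =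
          (if (i, j) # ps \<in> matricial_words then \<phi> (a \<otimes>\<^bsub>A\<^esub> list_product A as) else 0))"

definition matricially_free ::
  "'a star_algebra \<Rightarrow> 'i set \<Rightarrow> ('a \<Rightarrow> complex) \<Rightarrow> ('i \<Rightarrow> 'a \<Rightarrow> complex) \<Rightarrow>
     ('i \<Rightarrow> 'i \<Rightarrow> 'a set) \<Rightarrow> ('i \<Rightarrow> 'i \<Rightarrow> 'a) \<Rightarrow> bool" where
  "matricially_free A I \<phi> \<psi> \<A> e \<longleftrightarrow>
     algebra_array A I \<phi> \<psi> \<A> e \<and>
     (\<forall>ps as. ps \<noteq> [] \<and> kernel_sequence I \<phi> \<psi> \<A> ps as \<and> distinct_adj ps \<longrightarrow>
        \<phi> (list_product A as) = 0) \<and>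
     matricially_free_units A I \<phi> \<psi> \<A> e"

text \<open>
  The algebra \<open>\<complex>[a, e]\<close> has \<open>e\<close> as its unit, so it is generated by \<open>a\<close> and \<open>e\<close> as a subalgebra
  that need not contain the unit of \<open>A\<close>.
\<close>

definition matricially_free_variables ::
  "'a star_algebra \<Rightarrow> 'i set \<Rightarrow> ('a \<Rightarrow> complex) \<Rightarrow> ('i \<Rightarrow> 'a \<Rightarrow> complex) \<Rightarrow> ('i \<Rightarrow> 'i \<Rightarrow> 'a) \<Rightarrow> bool" where
  "matricially_free_variables A I \<phi> \<psi> X \<longleftrightarrow>
     (\<exists>e. (\<forall>i\<in>I. \<forall>j\<in>I. projection A (e i j)) \<and>
          matricially_free A I \<phi> \<psi> (\<lambda>i j. nonunital_subalgebra A hull {X i j, e i j}) e)"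


section \<open>Block form\<close>

definition block_interval :: "(nat \<Rightarrow> real) \<Rightarrow> nat \<Rightarrow> nat \<Rightarrow> nat set" where
  "block_interval d n k =
     {nat \<lfloor>(\<Sum>l<k. d l) * real n\<rfloor> <.. nat \<lfloor>(\<Sum>l<Suc k. d l) * real n\<rfloor>}"

text \<open>Rows and columns of matrices, and hence the blocks, are numbered from \<open>0\<close> to \<open>r - 1\<close>.\<close>

definition block_form ::
  "nat \<Rightarrow> (nat \<Rightarrow> real) \<Rightarrow> real mat \<Rightarrow> nat \<Rightarrow> (nat \<Rightarrow> nat \<Rightarrow> real) \<Rightarrow> bool" where
  "block_form r d U n v \<longleftrightarrow>
     (\<forall>i<r. \<forall>j<r. \<forall>p\<in>block_interval d n i. \<forall>q\<in>block_interval d n j. v p q = U $$ (i, j) / real n)"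


section \<open>Non-crossing pair partitions\<close>

definition noncrossing :: "nat set set \<Rightarrow> bool" where
  "noncrossing \<pi> \<longleftrightarrow>
     \<not> (\<exists>B\<in>\<pi>. \<exists>C\<in>\<pi>. B \<noteq> C \<and>
          (\<exists>a b c d. a < b \<and> b < c \<and> c < d \<and> a \<in> B \<and> c \<in> B \<and> b \<in> C \<and> d \<in> C))"

definition NC2 :: "nat set \<Rightarrow> nat set set set" where
  "NC2 S = {\<pi>. partition_on S \<pi> \<and> (\<forall>B\<in>\<pi>. card B = 2) \<and> noncrossing \<pi>}"

definition covered :: "nat set set \<Rightarrow> bool" where
  "covered \<pi> \<longleftrightarrow> (\<exists>a b. a \<le> b \<and> \<pi> \<in> NC2 {a..b} \<and> (\<exists>B\<in>\<pi>. a \<in> B \<and> b \<in> B))"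

text \<open>
  Partitions of intervals are not relabelled. If \<open>\<pi>\<close> is a partition of an interval, then the
  intervals underlying the members of \<open>\<pi>s\<close> are automatically consecutive.
\<close>

definition covered_decomposition :: "nat set set \<Rightarrow> nat set set list \<Rightarrow> bool" where
  "covered_decomposition \<pi> \<pi>s \<longleftrightarrow>
     (\<forall>\<sigma>\<in>set \<pi>s. covered \<sigma>) \<and>
     sorted_wrt (\<lambda>\<rho> \<sigma>. \<forall>x\<in>\<Union>\<rho>. \<forall>y\<in>\<Union>\<sigma>. x < y) \<pi>s \<and>
     \<Union>(set \<pi>s) = \<pi>"

definition covered_parts :: "nat set set \<Rightarrow> nat set set list" where
  "covered_parts \<pi> = (THE \<pi>s. covered_decomposition \<pi> \<pi>s)"

text \<open>For covered \<open>\<pi>\<close>: the covered parts of what remains after removing the outer block.\<close>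

definition inner_parts :: "nat set set \<Rightarrow> nat set set list" where
  "inner_parts \<pi> = covered_parts (\<pi> - {{Min (\<Union>\<pi>), Max (\<Union>\<pi>)}})"

lemma covered_nonempty: "covered \<sigma> \<Longrightarrow> \<sigma> \<noteq> {}"
  by (auto simp: covered_def)

lemma first_part:
  assumes "covered_decomposition \<pi> (\<sigma> # \<pi>s)"
  obtains a b B where "a \<in> B" "b \<in> B" "B \<in> \<pi>" "B \<subseteq> {a..b}" "\<sigma> = {C \<in> \<pi>. C \<subseteq> {a..b}}"
    "\<And>x. x \<in> \<Union>\<pi> \<Longrightarrow> a \<le> x" "\<And>C. C \<in> \<pi> \<Longrightarrow> a \<in> C \<Longrightarrow> C = B" "\<Union>(set \<pi>s) = \<pi> - \<sigma>"
proof -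
  from assms have "covered \<sigma>"
    and later: "\<And>\<rho> x y. \<rho> \<in> set \<pi>s \<Longrightarrow> x \<in> \<Union>\<sigma> \<Longrightarrow> y \<in> \<Union>\<rho> \<Longrightarrow> x < y"
    and un: "\<pi> = \<sigma> \<union> \<Union>(set \<pi>s)" and cov: "\<And>\<rho>. \<rho> \<in> set \<pi>s \<Longrightarrow> covered \<rho>"
    by (auto simp: covered_decomposition_def)
  then obtain a b B where ab: "\<sigma> \<in> NC2 {a..b}" "B \<in> \<sigma>" "a \<in> B" "b \<in> B"
    by (auto simp: covered_def)
  then have part: "partition_on {a..b} \<sigma>" by (simp add: NC2_def)
  then have U: "\<Union>\<sigma> = {a..b}" by (simp add: partition_on_def)
  have ne: "C \<noteq> {}" if "C \<in> \<rho>" "\<rho> \<in> set \<pi>s" for C \<rho>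
    using cov[OF that(2)] that(1) by (auto simp: covered_def NC2_def partition_on_def)
  have a: "a \<in> \<Union>\<sigma>" "b \<in> \<Union>\<sigma>" using ab by auto
  have out: "\<not> C \<subseteq> {a..b}" if "C \<in> \<rho>" "\<rho> \<in> set \<pi>s" for C \<rho>
  proof -
    have "C \<noteq> {}" using ne that by blast
    then obtain y where "y \<in> C" by auto
    then have "b < y" using later[OF that(2) a(2)] that by auto
    with \<open>y \<in> C\<close> show ?thesis by auto
  qed
  have \<sigma>: "\<sigma> = {C \<in> \<pi>. C \<subseteq> {a..b}}"
    using un U out by auto
  show ?thesis
  proof (rule that[of a B b])
    show "a \<in> B" "b \<in> B" "B \<in> \<pi>" "B \<subseteq> {a..b}" using ab un U by auto
    show "\<sigma> = {C \<in> \<pi>. C \<subseteq> {a..b}}" by (fact \<sigma>)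
    show "a \<le> x" if "x \<in> \<Union>\<pi>" for x
      using that un U later a by (fastforce intro: less_imp_le)
    show "\<Union>(set \<pi>s) = \<pi> - \<sigma>" using un \<sigma> out by auto
    show "C = B" if "C \<in> \<pi>" "a \<in> C" for C
    proof -
      have "C \<in> \<sigma>" using that un later[OF _ a(1), of _ a] by auto
      then show ?thesis using part ab that by (auto simp: partition_on_def dest: disjointD)
    qed
  qed
qed

lemma covered_decomposition_unique:
  "covered_decomposition \<pi> \<pi>s \<Longrightarrow> covered_decomposition \<pi> \<rho>s \<Longrightarrow> \<pi>s = \<rho>s"
proof (induction \<pi>s arbitrary: \<pi> \<rho>s)
  case Nil
  then have "\<pi> = {}" by (simp add: covered_decomposition_def)
  with Nil(2) show ?case
    by (cases \<rho>s) (auto simp: covered_decomposition_def dest: covered_nonempty)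
next
  case (Cons \<sigma> \<pi>s)
  have "\<pi> \<noteq> {}"
    using Cons.prems(1) covered_nonempty by (auto simp: covered_decomposition_def)
  then obtain \<tau> \<rho>s' where \<rho>s: "\<rho>s = \<tau> # \<rho>s'"
    using Cons.prems(2) by (cases \<rho>s) (auto simp: covered_decomposition_def)
  obtain a b B where 1: "a \<in> B" "b \<in> B" "B \<in> \<pi>" "B \<subseteq> {a..b}" "\<sigma> = {C \<in> \<pi>. C \<subseteq> {a..b}}"
    "\<And>x. x \<in> \<Union>\<pi> \<Longrightarrow> a \<le> x" "\<And>C. C \<in> \<pi> \<Longrightarrow> a \<in> C \<Longrightarrow> C = B" "\<Union>(set \<pi>s) = \<pi> - \<sigma>"
    by (rule first_part[OF Cons.prems(1)]) (rule that)
  obtain a' b' B' where 2: "a' \<in> B'" "b' \<in> B'" "B' \<in> \<pi>" "B' \<subseteq> {a'..b'}"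
    "\<tau> = {C \<in> \<pi>. C \<subseteq> {a'..b'}}" "\<And>x. x \<in> \<Union>\<pi> \<Longrightarrow> a' \<le> x"
    "\<And>C. C \<in> \<pi> \<Longrightarrow> a' \<in> C \<Longrightarrow> C = B'" "\<Union>(set \<rho>s') = \<pi> - \<tau>"
    by (rule first_part[OF Cons.prems(2)[unfolded \<rho>s]]) (rule that)
  have "a = a'"
    using 1(6)[of a'] 2(6)[of a] 1(1,3) 2(1,3) by (intro antisym) auto
  then have "B = B'" using 2(7)[of B] 1(1,3) by simp
  then have "b = b'" using 1(2,4) 2(2,4) by (intro antisym) auto
  then have "\<sigma> = \<tau>" using 1(5) 2(5) \<open>a = a'\<close> by simp
  have "covered_decomposition (\<pi> - \<sigma>) \<pi>s" "covered_decomposition (\<pi> - \<sigma>) \<rho>s'"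
    using Cons.prems 1(8) 2(8) \<rho>s \<open>\<sigma> = \<tau>\<close> by (auto simp: covered_decomposition_def)
  then show ?case using Cons.IH \<rho>s \<open>\<sigma> = \<tau>\<close> by auto
qed

lemma covered_decomposition_exists:
  "\<pi> \<in> NC2 {a..<b} \<Longrightarrow> \<exists>\<pi>s. covered_decomposition \<pi> \<pi>s"
proof (induction "b - a" arbitrary: a \<pi> rule: less_induct)
  case less
  show ?case
  proof (cases "a < b")
    case False
    then have "\<pi> = {}" using less.prems by (auto simp: NC2_def partition_on_def)
    then have "covered_decomposition \<pi> []" by (simp add: covered_decomposition_def)
    then show ?thesis ..
  next
    case True
    have part: "partition_on {a..<b} \<pi>" and two: "\<And>B. B \<in> \<pi> \<Longrightarrow> card B = 2"
      and nc: "noncrossing \<pi>" using less.prems by (auto simp: NC2_def)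
    have U: "\<Union>\<pi> = {a..<b}" using part by (simp add: partition_on_def)
    have uniq: "C = C'" if "C \<in> \<pi>" "C' \<in> \<pi>" "x \<in> C" "x \<in> C'" for C C' x
      using part that by (auto simp: partition_on_def dest: disjointD)
    have "a \<in> \<Union>\<pi>" using U True by simp
    then obtain B where B: "B \<in> \<pi>" "a \<in> B" by auto
    then obtain c where c: "B = {a, c}" "a \<noteq> c"
      using two[OF B(1)] by (auto simp: card_2_iff)
    have "c \<in> {a..<b}" using B c U by blast
    then have acb: "a < c" "c < b" using c by auto
    let ?\<sigma> = "{C \<in> \<pi>. C \<subseteq> {a..c}}"
    have in_or_out: "C \<subseteq> {a..c} \<or> C \<subseteq> {Suc c..<b}" if C: "C \<in> \<pi>" for C
    proof (cases "C = B")
      case False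
      obtain x y where xy: "C = {x, y}" "x < y"
        using two[OF C]
        by (metis card_2_iff insert_commute linorder_neqE_nat)
      have "a \<notin> C" "c \<notin> C" using uniq[OF C B(1)] False c by auto
      moreover have "x \<in> {a..<b}" "y \<in> {a..<b}" using U C xy by blast+
      moreover have "\<not> (a < x \<and> x < c \<and> c < y)"
      proof
        assume "a < x \<and> x < c \<and> c < y"
        moreover have "a \<in> B" "c \<in> B" "x \<in> C" "y \<in> C" using c xy by auto
        ultimately show False
          using nc B(1) C False unfolding noncrossing_def by metis
      qed
      ultimately show ?thesis using xy by auto
    qed (use c acb in auto)
    have ncs: "noncrossing \<rho>" if "\<rho> \<subseteq> \<pi>" for \<rho>
      using nc that unfolding noncrossing_def by blast
    have dis: "disjoint \<rho>" if "\<rho> \<subseteq> \<pi>" for \<rho>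
      using part that unfolding partition_on_def by (meson pairwise_subset)
    have \<sigma>U: "\<Union>?\<sigma> = {a..c}"
    proof
      show "{a..c} \<subseteq> \<Union>?\<sigma>"
      proof
        fix x assume x: "x \<in> {a..c}"
        then have "x \<in> \<Union>\<pi>" using U acb by auto
        then obtain C where C: "C \<in> \<pi>" "x \<in> C" by auto
        then have "C \<subseteq> {a..c}" using in_or_out[OF C(1)] x by auto
        then show "x \<in> \<Union>?\<sigma>" using C by auto
      qed
    qed auto
    have \<rho>U: "\<Union>(\<pi> - ?\<sigma>) = {Suc c..<b}"
    proof
      show "\<Union>(\<pi> - ?\<sigma>) \<subseteq> {Suc c..<b}" using in_or_out by blast
      show "{Suc c..<b} \<subseteq> \<Union>(\<pi> - ?\<sigma>)"
      proof
        fix x assume x: "x \<in> {Suc c..<b}"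
        then have "x \<in> \<Union>\<pi>" using U acb by auto
        then obtain C where C: "C \<in> \<pi>" "x \<in> C" by auto
        then have "\<not> C \<subseteq> {a..c}" using x by auto
        then show "x \<in> \<Union>(\<pi> - ?\<sigma>)" using C by auto
      qed
    qed
    have "?\<sigma> \<in> NC2 {a..c}"
      using \<sigma>U dis[of ?\<sigma>] ncs[of ?\<sigma>] two part by (auto simp: NC2_def partition_on_def)
    then have cov: "covered ?\<sigma>"
      unfolding covered_def using B c acb by (intro exI[of _ a] exI[of _ c]) auto
    have "\<pi> - ?\<sigma> \<in> NC2 {Suc c..<b}"
      using \<rho>U dis[of "\<pi> - ?\<sigma>"] ncs[of "\<pi> - ?\<sigma>"] two part by (auto simp: NC2_def partition_on_def)
    moreover have "b - Suc c < b - a" using acb by simp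
    ultimately obtain \<pi>s where \<pi>s: "covered_decomposition (\<pi> - ?\<sigma>) \<pi>s"
      using less.hyps by blast
    have "x < y" if "x \<in> \<Union>?\<sigma>" "\<rho> \<in> set \<pi>s" "y \<in> \<Union>\<rho>" for x y \<rho>
    proof -
      have "y \<in> \<Union>(\<pi> - ?\<sigma>)" using \<pi>s that unfolding covered_decomposition_def by blast
      then show ?thesis using that(1) \<sigma>U \<rho>U by auto
    qed
    moreover have "?\<sigma> \<union> \<Union>(set \<pi>s) = \<pi>"
      using \<pi>s unfolding covered_decomposition_def by blast
    ultimately have "covered_decomposition \<pi> (?\<sigma> # \<pi>s)"
      using \<pi>s cov unfolding covered_decomposition_def by auto
    then show ?thesis ..
  qed
qed

lemma covered_parts:
  assumes "\<pi> \<in> NC2 {a..<b}"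
  shows "covered_decomposition \<pi> (covered_parts \<pi>)"
  unfolding covered_parts_def using covered_decomposition_exists[OF assms]
  by (metis covered_decomposition_unique theI)

lemma inner_partition:
  assumes "covered \<pi>"
  obtains a b where "\<pi> - {{Min (\<Union>\<pi>), Max (\<Union>\<pi>)}} \<in> NC2 {Suc a..<b}"
    "{Min (\<Union>\<pi>), Max (\<Union>\<pi>)} \<in> \<pi>"
proof -
  obtain a b B where ab: "a \<le> b" "\<pi> \<in> NC2 {a..b}" "B \<in> \<pi>" "a \<in> B" "b \<in> B"
    using assms by (auto simp: covered_def)
  then have part: "partition_on {a..b} \<pi>" and two: "\<And>B. B \<in> \<pi> \<Longrightarrow> card B = 2"
    and nc: "noncrossing \<pi>" by (auto simp: NC2_def)
  have U: "\<Union>\<pi> = {a..b}" using part by (simp add: partition_on_def)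
  have "a \<noteq> b"
  proof
    assume "a = b"
    then have "B \<subseteq> {a}" using U ab by auto
    then show False using two[OF ab(3)] by (metis card_mono card.empty card_insert_disjoint
          finite.emptyI finite.insertI empty_iff Suc_1 not_less_eq_eq le_refl One_nat_def)
  qed
  then have B: "B = {a, b}" using two[OF ab(3)] ab by (auto simp: card_2_iff)
  have mm: "{Min (\<Union>\<pi>), Max (\<Union>\<pi>)} = B"
  proof -
    have "Min {a..b} = a" "Max {a..b} = b" using ab(1) by (auto intro: Min_eqI Max_eqI)
    then show ?thesis by (simp add: U B)
  qed
  have "\<Union>(\<pi> - {B}) = \<Union>\<pi> - B"
  proof -
    have "C \<inter> B = {}" if "C \<in> \<pi>" "C \<noteq> B" for C
      using part that ab(3) by (auto simp: partition_on_def dest: disjointD)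
    then show ?thesis using ab(3) by blast
  qed
  moreover have "\<Union>\<pi> - B = {Suc a..<b}" unfolding U B by auto
  ultimately have "\<Union>(\<pi> - {B}) = {Suc a..<b}" by (rule trans)
  moreover have "disjoint (\<pi> - {B})"
    using part unfolding partition_on_def by (meson Diff_subset pairwise_subset)
  moreover have "noncrossing (\<pi> - {B})"
    using nc unfolding noncrossing_def by blast
  ultimately have "\<pi> - {B} \<in> NC2 {Suc a..<b}"
    using part two by (auto simp: NC2_def partition_on_def)
  then show ?thesis using that[of a b] mm ab(3) by simp
qed


section \<open>The matrices \<open>V(\<pi>)\<close> and the function \<open>v\<^sub>0\<close>\<close>

text \<open>The operation \<open>\<tau>\<close>; it uses column sums, not row sums.\<close>

definition column_sum_diag :: "real mat \<Rightarrow> real mat" where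
  "column_sum_diag V = mat_diag (dim_col V) (\<lambda>i. \<Sum>j<dim_row V. V $$ (j, i))"

definition diagonal_part :: "real mat \<Rightarrow> real mat" where
  "diagonal_part V = mat_diag (dim_row V) (\<lambda>i. V $$ (i, i))"

definition mat_trace :: "real mat \<Rightarrow> real" where
  "mat_trace V = (\<Sum>i<dim_row V. V $$ (i, i))"

definition mat_product :: "nat \<Rightarrow> real mat list \<Rightarrow> real mat" where
  "mat_product s Ms = foldr (*) Ms (1\<^sub>m s)"

text \<open>The value outside the non-crossing pair partitions of intervals is irrelevant.\<close>

function partition_matrix :: "real mat \<Rightarrow> nat set set \<Rightarrow> real mat" where
  "partition_matrix V \<pi> =
     (if \<not> (\<exists>a b. \<pi> \<in> NC2 {a..<b}) then undefined
      else if covered \<pi> then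
        (if card \<pi> = 1 then column_sum_diag V
         else column_sum_diag (mat_product (dim_row V) (map (partition_matrix V) (inner_parts \<pi>)) * V))
      else mat_product (dim_row V) (map (partition_matrix V) (covered_parts \<pi>)))"
  by pat_completeness auto
termination
proof (relation "Wellfounded.measure (\<lambda>(V, \<pi>). card \<pi>)", goal_cases)
  case 1
  show ?case by simp
next
  case (2 V \<pi> \<sigma>)
  let ?B = "{Min (\<Union>\<pi>), Max (\<Union>\<pi>)}"
  from 2 have fin: "finite \<pi>"
    by (auto simp: NC2_def intro: finite_elements)
  have "covered \<pi>" and \<sigma>: "\<sigma> \<in> set (inner_parts \<pi>)" using 2 by auto
  obtain a b where ab: "\<pi> - {?B} \<in> NC2 {Suc a..<b}" "?B \<in> \<pi>"
    by (rule inner_partition[OF \<open>covered \<pi>\<close>])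
  have "\<Union>(set (inner_parts \<pi>)) = \<pi> - {?B}"
    using covered_parts[OF ab(1)] by (simp only: inner_parts_def covered_decomposition_def)
  then have "\<sigma> \<subseteq> \<pi> - {?B}" using \<sigma> by blast
  then have "\<sigma> \<subset> \<pi>" using ab(2) by blast
  then show ?case using fin by (simp add: psubset_card_mono)
next
  case (3 V \<pi> \<sigma>)
  from 3 have fin: "finite \<pi>"
    by (auto simp: NC2_def intro: finite_elements)
  from 3 obtain a b where "\<pi> \<in> NC2 {a..<b}" by blast
  from covered_parts[OF this] have "covered \<sigma>" "\<sigma> \<subseteq> \<pi>"
    using 3 unfolding covered_decomposition_def by blast+
  then have "\<sigma> \<subset> \<pi>" using 3 by blast
  then show ?case using fin by (simp add: psubset_card_mono)
qed

declare partition_matrix.simps [simp del]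

definition covered_matrix0 :: "real mat \<Rightarrow> nat set set \<Rightarrow> real mat" where
  "covered_matrix0 V \<pi> =
     (if card \<pi> = 1 then diagonal_part V
      else column_sum_diag (mat_product (dim_row V) (map (partition_matrix V) (inner_parts \<pi>)) * diagonal_part V))"

definition v0 :: "real mat \<Rightarrow> nat set set \<Rightarrow> real" where
  "v0 V \<pi> = prod_list (map (\<lambda>\<sigma>. mat_trace (covered_matrix0 V \<sigma>)) (covered_parts \<pi>))"

end

theory Submission
  imports Defs
begin

text \<open>
  Expand the power of the sum \<open>S\<close> from the right and write every power \<open>X\<^sub>p\<^sup>k\<close> as its centered part plus
  a multiple of the unit \<open>1\<^sub>p\<close>. Matricial freeness turns this into a walk on stacks: the current
  product is a reduced word of centered powers whose index pairs chain as \<open>(i\<^sub>1,i\<^sub>2), (i\<^sub>2,i\<^sub>3), \<dots>, (i\<^sub>h,i\<^sub>h)\<close>,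
  and multiplication by \<open>S\<close> either pushes a new letter, where only the first index is free, or
  raises, resets or pops the top letter, at the cost of a moment in the last two cases. Since a moment of order \<open>k\<close> is
  \<open>O(n\<^sup>-\<^sup>k\<^sup>/\<^sup>2)\<close> and every push has at most \<open>n\<close> choices, only walks consisting of pushes and of pops of first powers, weighted by
  variances, survive in the limit. These are Dyck walks with weights depending on the blocks, and their first-return
  decomposition is the decomposition of a non-crossing pair partition according to the
  block of its smallest element.
\<close>

section \<open>Sums over non-crossing pair partitions\<close>

text \<open>The quantities \<open>\<phi> (total [^] m \<otimes> word s)\<close> are therefore closed
  under one-step expansion.

  A stack of height \<open>h\<close> has a mixed moment of order at most \<open>n^(-h)\<close>,
  since every letter still has to be paired. The induction thus compares \<open>n^h\<close> times
  the mixed moment with a limit weight; under this scaling a push becomes an average over indices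
  and a pop absorbs a variance. Raised letters leave the family of stacks that have a limit weight,
  so an a priori bound for arbitrary stacks has to come first.

  The matrices of the limit can be read off the stack. Popping a letter of block \<open>b\<close>
  above one of block \<open>b'\<close> costs \<open>U $$ (b, b')\<close>, and its push has frequency
  \<open>d b\<close>; together they give an entry of \<open>DU\<close> that is summed over
  \<open>b\<close>, hence the column sums. A bottom letter has a diagonal index pair and costs
  \<open>U $$ (b, b)\<close>, hence the diagonal matrix for outer blocks in
  \<open>v0\<close>.\<close>

lemma covered_parts_eqI: "covered_decomposition \<pi> \<pi>s \<Longrightarrow> covered_parts \<pi> = \<pi>s"
  unfolding covered_parts_def by (rule the_equality) (auto intro: covered_decomposition_unique)

lemma finite_NC2: "finite S \<Longrightarrow> finite (NC2 S)"
  by (rule finite_subset[of _ "Pow (Pow S)"]) (auto simp: NC2_def partition_on_def)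

lemma NC2_empty [simp]: "NC2 {} = {{}}"
  by (auto simp: NC2_def noncrossing_def partition_on_def)

lemma NC2_Union: "\<pi> \<in> NC2 S \<Longrightarrow> \<Union>\<pi> = S"
  by (simp add: NC2_def partition_on_def)

lemma NC2_block_nonempty: "\<pi> \<in> NC2 S \<Longrightarrow> B \<in> \<pi> \<Longrightarrow> B \<noteq> {}"
  by (auto simp: NC2_def partition_on_def)

lemma NC2_block_unique:
  assumes "\<pi> \<in> NC2 S" "B \<in> \<pi>" "C \<in> \<pi>" "x \<in> B" "x \<in> C"
  shows "B = C"
  using assms by (auto simp: NC2_def partition_on_def dest: disjointD)

lemma NC2_restrict:
  assumes "\<pi> \<in> NC2 S" "\<sigma> \<subseteq> \<pi>"
  shows "\<sigma> \<in> NC2 (\<Union>\<sigma>)"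
proof -
  have "disjoint \<sigma>"
    using assms unfolding NC2_def partition_on_def by (blast intro: pairwise_subset)
  moreover have "noncrossing \<sigma>"
    using assms unfolding NC2_def noncrossing_def by blast
  ultimately show ?thesis using assms by (auto simp: NC2_def partition_on_def)
qed

lemma noncrossingI:
  assumes "\<And>B C x y z w. B \<in> \<pi> \<Longrightarrow> C \<in> \<pi> \<Longrightarrow> B \<noteq> C \<Longrightarrow> x < y \<Longrightarrow> y < z \<Longrightarrow> z < w \<Longrightarrow>
    x \<in> B \<Longrightarrow> z \<in> B \<Longrightarrow> y \<in> C \<Longrightarrow> w \<in> C \<Longrightarrow> False"
  shows "noncrossing \<pi>"
  unfolding noncrossing_def by (intro notI, elim bexE exE conjE, rule assms)

lemma noncrossingD:
  assumes "noncrossing \<pi>" "B \<in> \<pi>" "C \<in> \<pi>" "B \<noteq> C" "x < y" "y < z" "z < w"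
    "x \<in> B" "z \<in> B" "y \<in> C" "w \<in> C"
  shows False
  using assms(1) unfolding noncrossing_def
  by (rule notE, intro bexI[of _ B] bexI[of _ C] conjI exI[of _ x] exI[of _ y] exI[of _ z] exI[of _ w] assms)

lemma NC2_noncrossing: "\<pi> \<in> NC2 S \<Longrightarrow> noncrossing \<pi>"
  by (simp add: NC2_def)

lemma NC2_insert:
  assumes "a < c" "c < b" "\<sigma> \<in> NC2 {Suc a..<c}" "\<rho> \<in> NC2 {Suc c..<b}"
  shows "insert {a, c} (\<sigma> \<union> \<rho>) \<in> NC2 {a..<b}"
proof -
  let ?\<pi> = "insert {a, c} (\<sigma> \<union> \<rho>)"
  have U: "\<Union>\<sigma> = {Suc a..<c}" "\<Union>\<rho> = {Suc c..<b}" using assms NC2_Union by auto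
  have sub: "B \<subseteq> {Suc a..<c}" if "B \<in> \<sigma>" for B using U that by auto
  have sub': "B \<subseteq> {Suc c..<b}" if "B \<in> \<rho>" for B using U that by auto
  have dis: "B \<inter> C = {}" if "B \<in> ?\<pi>" "C \<in> ?\<pi>" "B \<noteq> C" for B C
  proof (rule ccontr)
    assume "B \<inter> C \<noteq> {}"
    then obtain x where x: "x \<in> B" "x \<in> C" by auto
    show False
    proof (cases "x = a \<or> x = c")
      case True
      then have "D = {a, c}" if "D \<in> ?\<pi>" "x \<in> D" for D
        using that sub[of D] sub'[of D] \<open>a < c\<close> by force
      then show False using x \<open>B \<in> ?\<pi>\<close> \<open>C \<in> ?\<pi>\<close> \<open>B \<noteq> C\<close> by metis
    next
      case False
      then have D: "D \<in> \<sigma> \<and> x < c \<or> D \<in> \<rho> \<and> c < x" if "D \<in> ?\<pi>" "x \<in> D" for D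
        using that sub[of D] sub'[of D] by force
      show False
        using D[of B] D[of C] that x NC2_block_unique[OF assms(3), of B C x]
          NC2_block_unique[OF assms(4), of B C x] by (metis less_asym)
    qed
  qed
  have un: "\<Union>?\<pi> = {a..<b}" using U assms(1,2) by auto
  have two: "card B = 2" if "B \<in> ?\<pi>" for B
    using that assms by (auto simp: NC2_def)
  have "noncrossing ?\<pi>"
  proof (rule noncrossingI)
    fix B C x y z w
    assume B: "B \<in> ?\<pi>" "C \<in> ?\<pi>" "B \<noteq> C"
      and o: "x < y" "y < z" "z < w" "x \<in> B" "z \<in> B" "y \<in> C" "w \<in> C"
    have \<sigma>: "\<not> (B \<in> \<sigma> \<and> C \<in> \<sigma>)" and \<rho>: "\<not> (B \<in> \<rho> \<and> C \<in> \<rho>)"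
      using noncrossingD[OF NC2_noncrossing[OF assms(3)] _ _ B(3) o]
        noncrossingD[OF NC2_noncrossing[OF assms(4)] _ _ B(3) o] by blast+
    have s: "a < u \<and> u < c" if "u \<in> D" "D \<in> \<sigma>" for u D using sub[OF that(2)] that by auto
    have r: "c < u" if "u \<in> D" "D \<in> \<rho>" for u D using sub'[OF that(2)] that by auto
    consider "B = {a, c}" | "B \<in> \<sigma>" | "B \<in> \<rho>" using B(1) by blast
    then show False
    proof cases
      case 1
      then have "x = a" "z = c" using o \<open>a < c\<close> by auto
      then have "a < y" "y < c" "c < w" using o by auto
      moreover have "C \<noteq> {a, c}" using 1 B(3) by simp
      ultimately show False using s[OF \<open>w \<in> C\<close>] r[OF \<open>y \<in> C\<close>] B(2) by auto
    next
      case 2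
      then have "a < y" "y < c" using s[OF \<open>x \<in> B\<close>] s[OF \<open>z \<in> B\<close>] o by auto
      then show False using r[OF \<open>y \<in> C\<close>] B(2) \<open>y \<in> C\<close> 2 \<sigma> by auto
    next
      case 3
      then have "c < y" using r[OF \<open>x \<in> B\<close>] o by auto
      then show False using s[OF \<open>y \<in> C\<close>] B(2) \<open>y \<in> C\<close> \<open>a < c\<close> 3 \<rho> by auto
    qed
  qed
  moreover have "disjoint ?\<pi>" using dis by (rule disjointI)
  moreover have "{} \<notin> ?\<pi>" using two by force
  ultimately show ?thesis using un two by (simp add: NC2_def partition_on_def)
qed

text \<open>A block with one end strictly between \<open>a\<close> and \<open>c\<close> and the
  other beyond \<open>c\<close> would cross \<open>{a, c}\<close>, so every other block lies on one
  side of \<open>c\<close>. Once the partner of the smallest point is chosen, two independent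
  smaller partitions remain.\<close>

lemma NC2_split:
  assumes "\<pi> \<in> NC2 {a..<b}" "a < b"
  obtains c \<sigma> \<rho> where "a < c" "c < b" "\<sigma> \<in> NC2 {Suc a..<c}" "\<rho> \<in> NC2 {Suc c..<b}"
    "\<pi> = insert {a, c} (\<sigma> \<union> \<rho>)"
proof -
  have U: "\<Union>\<pi> = {a..<b}" using NC2_Union[OF assms(1)] .
  have two: "card B = 2" if "B \<in> \<pi>" for B using assms(1) that by (auto simp: NC2_def)
  obtain B where B: "B \<in> \<pi>" "a \<in> B" using U assms(2) by (metis UnionE atLeastLessThan_iff order_refl)
  then obtain c where c: "B = {a, c}" "a \<noteq> c" using two[OF B(1)] by (auto simp: card_2_iff)
  have "c \<in> {a..<b}" using B c U by blast
  then have ac: "a < c" "c < b" using c(2) by auto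
  let ?\<sigma> = "{C \<in> \<pi>. C \<subseteq> {Suc a..<c}}" and ?\<rho> = "{C \<in> \<pi>. C \<subseteq> {Suc c..<b}}"
  have cases: "C = B \<or> C \<in> ?\<sigma> \<or> C \<in> ?\<rho>" if C: "C \<in> \<pi>" for C
  proof (cases "C = B")
    case False
    obtain x y where xy: "C = {x, y}" "x < y"
      using two[OF C] by (metis card_2_iff insert_commute linorder_neqE_nat)
    have "a \<notin> C" "c \<notin> C" using NC2_block_unique[OF assms(1) C B(1)] False c by auto
    moreover have "x \<in> {a..<b}" "y \<in> {a..<b}" using U C xy by blast+
    moreover have "\<not> (a < x \<and> x < c \<and> c < y)"
    proof
      assume "a < x \<and> x < c \<and> c < y"
      moreover have "a \<in> B" "c \<in> B" "x \<in> C" "y \<in> C" using c xy by auto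
      ultimately show False
        using noncrossingD[OF NC2_noncrossing[OF assms(1)] B(1) C] False by blast
    qed
    ultimately show ?thesis using C xy by (auto simp: Suc_le_eq)
  qed simp
  have in_or: "x = a \<or> x = c \<or> x \<in> \<Union>?\<sigma> \<or> x \<in> \<Union>?\<rho>" if x: "x \<in> {a..<b}" for x
  proof -
    obtain C where "C \<in> \<pi>" "x \<in> C" using x U by blast
    then show ?thesis using cases[of C] c by blast
  qed
  have "\<Union>?\<sigma> = {Suc a..<c}"
  proof
    show "{Suc a..<c} \<subseteq> \<Union>?\<sigma>"
    proof
      fix x assume "x \<in> {Suc a..<c}"
      moreover from this have "x \<noteq> a" "x \<noteq> c" "x \<notin> \<Union>?\<rho>" by auto
      ultimately show "x \<in> \<Union>?\<sigma>" using in_or[of x] ac by simp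
    qed
  qed auto
  moreover have "\<Union>?\<rho> = {Suc c..<b}"
  proof
    show "{Suc c..<b} \<subseteq> \<Union>?\<rho>"
    proof
      fix x assume "x \<in> {Suc c..<b}"
      moreover from this have "x \<noteq> a" "x \<noteq> c" "x \<notin> \<Union>?\<sigma>" using ac by auto
      ultimately show "x \<in> \<Union>?\<rho>" using in_or[of x] ac by simp
    qed
  qed auto
  moreover have "\<pi> = insert {a, c} (?\<sigma> \<union> ?\<rho>)" using cases B c by blast
  moreover have "?\<sigma> \<subseteq> \<pi>" "?\<rho> \<subseteq> \<pi>" by auto
  ultimately show ?thesis
    using that[of c ?\<sigma> ?\<rho>] ac NC2_restrict[OF assms(1), of ?\<sigma>] NC2_restrict[OF assms(1), of ?\<rho>]
    by metis
qed

lemma sum_NC2: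
  assumes "a < b"
  shows "(\<Sum>\<pi>\<in>NC2 {a..<b}. f \<pi>) =
    (\<Sum>c\<in>{Suc a..<b}. \<Sum>\<sigma>\<in>NC2 {Suc a..<c}. \<Sum>\<rho>\<in>NC2 {Suc c..<b}. f (insert {a, c} (\<sigma> \<union> \<rho>)))"
proof -
  let ?S = "SIGMA c:{Suc a..<b}. NC2 {Suc a..<c} \<times> NC2 {Suc c..<b}"
  let ?h = "\<lambda>(c, \<sigma>, \<rho>). insert {a, c} (\<sigma> \<union> \<rho>)"
  \<comment> \<open>Injectivity: \<open>\<sigma>\<close> and \<open>\<rho>\<close> are recovered by
    location. Blocks are non-empty, so none fits into both intervals.\<close>
  have recover: "\<sigma> = {B \<in> insert {a, c} (\<sigma> \<union> \<rho>). B \<subseteq> {Suc a..<c}}"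
    "\<rho> = {B \<in> insert {a, c} (\<sigma> \<union> \<rho>). B \<subseteq> {Suc c..<b}}"
    if "\<sigma> \<in> NC2 {Suc a..<c}" "\<rho> \<in> NC2 {Suc c..<b}" for c \<sigma> \<rho>
  proof -
    have U: "\<And>B. B \<in> \<sigma> \<Longrightarrow> B \<subseteq> {Suc a..<c}" "\<And>B. B \<in> \<rho> \<Longrightarrow> B \<subseteq> {Suc c..<b}"
      using that NC2_Union by blast+
    have ne: "\<And>B. B \<in> \<sigma> \<Longrightarrow> B \<noteq> {}" "\<And>B. B \<in> \<rho> \<Longrightarrow> B \<noteq> {}"
      using that NC2_block_nonempty by blast+
    have "{Suc a..<c} \<inter> {Suc c..<b} = {}" by auto
    then have "B \<notin> \<sigma>" if "B \<subseteq> {Suc c..<b}" for B using U(1)[of B] ne(1)[of B] that by blast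
    moreover have "B \<notin> \<rho>" if "B \<subseteq> {Suc a..<c}" for B
      using \<open>{Suc a..<c} \<inter> {Suc c..<b} = {}\<close> U(2)[of B] ne(2)[of B] that by blast
    moreover have "\<not> {a, c} \<subseteq> {Suc a..<c}" "\<not> {a, c} \<subseteq> {Suc c..<b}" by auto
    ultimately show "\<sigma> = {B \<in> insert {a, c} (\<sigma> \<union> \<rho>). B \<subseteq> {Suc a..<c}}"
      "\<rho> = {B \<in> insert {a, c} (\<sigma> \<union> \<rho>). B \<subseteq> {Suc c..<b}}"
      by (auto dest: U simp del: atLeastLessThan_iff insert_subset)
  qed
  have inj: "inj_on ?h ?S"
  proof (rule inj_onI)
    fix x y assume "x \<in> ?S" "y \<in> ?S" and e: "?h x = ?h y"
    then obtain c \<sigma> \<rho> c' \<sigma>' \<rho>' where x: "x = (c, \<sigma>, \<rho>)" "y = (c', \<sigma>', \<rho>')"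
      and c: "a < c" "c < b" "a < c'" "c' < b"
      and m: "\<sigma> \<in> NC2 {Suc a..<c}" "\<rho> \<in> NC2 {Suc c..<b}"
         "\<sigma>' \<in> NC2 {Suc a..<c'}" "\<rho>' \<in> NC2 {Suc c'..<b}"
      by (auto simp: Suc_le_eq)
    have e': "insert {a, c} (\<sigma> \<union> \<rho>) = insert {a, c'} (\<sigma>' \<union> \<rho>')" using e x by simp
    have "{a, c} \<in> insert {a, c} (\<sigma> \<union> \<rho>)" "{a, c'} \<in> insert {a, c} (\<sigma> \<union> \<rho>)"
      using e' by auto
    then have "{a, c} = {a, c'}"
      using NC2_block_unique[OF NC2_insert[OF c(1,2) m(1,2)]] by blast
    then have "c = c'" by (auto simp: doubleton_eq_iff)
    then show "x = y" using recover[OF m(1,2)] recover[OF m(3,4)] e' x by metis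
  qed
  have img: "?h ` ?S = NC2 {a..<b}"
  proof
    show "?h ` ?S \<subseteq> NC2 {a..<b}" by (auto simp: Suc_le_eq intro: NC2_insert)
    show "NC2 {a..<b} \<subseteq> ?h ` ?S"
    proof
      fix \<pi> assume "\<pi> \<in> NC2 {a..<b}"
      then obtain c \<sigma> \<rho> where "a < c" "c < b" "\<sigma> \<in> NC2 {Suc a..<c}" "\<rho> \<in> NC2 {Suc c..<b}"
        "\<pi> = insert {a, c} (\<sigma> \<union> \<rho>)" using assms by (rule NC2_split)
      then show "\<pi> \<in> ?h ` ?S" by (intro image_eqI[of _ _ "(c, \<sigma>, \<rho>)"]) (auto simp: Suc_le_eq)
    qed
  qed
  have "(\<Sum>\<pi>\<in>NC2 {a..<b}. f \<pi>) = (\<Sum>x\<in>?S. f (?h x))"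
    unfolding img[symmetric] by (subst sum.reindex[OF inj]) simp
  also have "\<dots> = (\<Sum>c\<in>{Suc a..<b}. \<Sum>p\<in>NC2 {Suc a..<c} \<times> NC2 {Suc c..<b}. f (?h (c, p)))"
    by (subst sum.Sigma) (auto intro!: sum.cong finite_cartesian_product finite_NC2)
  also have "\<dots> = (\<Sum>c\<in>{Suc a..<b}. \<Sum>\<sigma>\<in>NC2 {Suc a..<c}. \<Sum>\<rho>\<in>NC2 {Suc c..<b}.
      f (insert {a, c} (\<sigma> \<union> \<rho>)))"
    by (subst sum.cartesian_product) (simp add: case_prod_unfold)
  finally show ?thesis .
qed

lemma covered_insert:
  assumes "a < c" "\<sigma> \<in> NC2 {Suc a..<c}"
  shows "insert {a, c} \<sigma> \<in> NC2 {a..c}" "covered (insert {a, c} \<sigma>)"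
proof -
  have "insert {a, c} (\<sigma> \<union> {}) \<in> NC2 {a..<Suc c}"
    using assms by (intro NC2_insert) auto
  then show *: "insert {a, c} \<sigma> \<in> NC2 {a..c}" by (simp add: atLeastLessThanSuc_atLeastAtMost)
  show "covered (insert {a, c} \<sigma>)"
    unfolding covered_def using * assms by (intro exI[of _ a] exI[of _ c]) auto
qed

lemma covered_parts_empty [simp]: "covered_parts {} = []"
  by (rule covered_parts_eqI) (simp add: covered_decomposition_def)

lemma covered_parts_covered: "covered \<sigma> \<Longrightarrow> covered_parts \<sigma> = [\<sigma>]"
  by (rule covered_parts_eqI) (simp add: covered_decomposition_def)

text \<open>The block of the smallest point closes the first covered part. Peeling off that part
  therefore matches the splitting in \<open>sum_NC2\<close>, which makes both kinds of decomposition
  accessible to one recursion.\<close>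

lemma covered_parts_insert:
  assumes "a < c" "c < b" "\<sigma> \<in> NC2 {Suc a..<c}" "\<rho> \<in> NC2 {Suc c..<b}"
  shows "covered_parts (insert {a, c} (\<sigma> \<union> \<rho>)) = insert {a, c} \<sigma> # covered_parts \<rho>"
proof (rule covered_parts_eqI)
  have dec: "covered_decomposition \<rho> (covered_parts \<rho>)" using assms(4) by (rule covered_parts)
  have "\<Union>(insert {a, c} \<sigma>) = {a..c}" by (rule NC2_Union[OF covered_insert(1)[OF assms(1,3)]])
  moreover have "\<Union>\<rho> = {Suc c..<b}" by (rule NC2_Union[OF assms(4)])
  moreover have "\<Union>\<tau> \<subseteq> \<Union>\<rho>" if "\<tau> \<in> set (covered_parts \<rho>)" for \<tau>
    using dec that by (auto simp: covered_decomposition_def)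
  ultimately have "x < y" if "\<tau> \<in> set (covered_parts \<rho>)" "x \<in> \<Union>(insert {a, c} \<sigma>)" "y \<in> \<Union>\<tau>" for \<tau> x y
  proof -
    have "x \<in> {a..c}" "y \<in> {Suc c..<b}"
      using that \<open>\<Union>(insert {a, c} \<sigma>) = {a..c}\<close> \<open>\<Union>\<rho> = {Suc c..<b}\<close>
        \<open>\<And>\<tau>. \<tau> \<in> set (covered_parts \<rho>) \<Longrightarrow> \<Union>\<tau> \<subseteq> \<Union>\<rho>\<close> by (metis, metis subsetD)
    then show ?thesis by simp
  qed
  then have "\<forall>\<tau>\<in>set (covered_parts \<rho>). \<forall>x\<in>\<Union>(insert {a, c} \<sigma>). \<forall>y\<in>\<Union>\<tau>. x < y"
    by blast
  then show "covered_decomposition (insert {a, c} (\<sigma> \<union> \<rho>)) (insert {a, c} \<sigma> # covered_parts \<rho>)"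
    using dec covered_insert(2)[OF assms(1,3)] by (auto simp: covered_decomposition_def)
qed

lemma outer_notin: "a < c \<Longrightarrow> \<sigma> \<in> NC2 {Suc a..<c} \<Longrightarrow> {a, c} \<notin> \<sigma>"
  using NC2_Union by fastforce

lemma inner_parts_insert:
  assumes "a < c" "\<sigma> \<in> NC2 {Suc a..<c}"
  shows "inner_parts (insert {a, c} \<sigma>) = covered_parts \<sigma>"
proof -
  have "\<Union>(insert {a, c} \<sigma>) = {a..c}" by (rule NC2_Union[OF covered_insert(1)[OF assms]])
  moreover have "Min {a..c} = a" "Max {a..c} = c" using assms(1) by (auto intro: Min_eqI Max_eqI)
  ultimately show ?thesis using outer_notin[OF assms] by (simp add: inner_parts_def del: Union_insert)
qed

lemma card_insert_eq_1:
  assumes "a < c" "\<sigma> \<in> NC2 {Suc a..<c}"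
  shows "card (insert {a, c} \<sigma>) = 1 \<longleftrightarrow> \<sigma> = {}"
proof -
  have "finite \<sigma>" using assms(2) by (auto simp: NC2_def intro: finite_elements)
  then show ?thesis using outer_notin[OF assms] by simp
qed

lemma sum_sum_mult_swap:
  fixes p :: "'b \<Rightarrow> 'c \<Rightarrow> 'd :: comm_semiring_0"
  shows "(\<Sum>\<sigma>\<in>S. \<Sum>\<rho>\<in>T. (\<Sum>j\<in>J. p \<sigma> j * w j) * q \<rho>) = (\<Sum>j\<in>J. (\<Sum>\<sigma>\<in>S. p \<sigma> j) * w j) * (\<Sum>\<rho>\<in>T. q \<rho>)"
proof -
  have "(\<Sum>\<sigma>\<in>S. \<Sum>j\<in>J. p \<sigma> j * w j) = (\<Sum>j\<in>J. (\<Sum>\<sigma>\<in>S. p \<sigma> j) * w j)"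
    by (subst sum.swap) (simp add: sum_distrib_right)
  then show ?thesis by (simp add: sum_product[symmetric])
qed

section \<open>Diagonal entries of the partition matrices\<close>

lemma column_sum_diag_mult:
  assumes "V \<in> carrier_mat s s"
  shows "column_sum_diag (mat_diag s f * V) = mat_diag s (\<lambda>i. \<Sum>j<s. f j * V $$ (j, i))"
  using assms by (subst mat_diag_mult_left) (auto simp: column_sum_diag_def mat_diag_def intro!: eq_matI)

lemma partition_matrix_empty: "partition_matrix V {} = 1\<^sub>m (dim_row V)"
proof -
  have "\<exists>a b. {} \<in> NC2 {a..<b::nat}" by (intro exI[of _ 0]) simp
  moreover have "\<not> covered {}" using covered_nonempty by blast
  ultimately show ?thesis by (subst partition_matrix.simps) (simp add: mat_product_def)
qed

context
  fixes V :: "real mat" and s :: nat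
  assumes V: "V \<in> carrier_mat s s"
begin

text \<open>The definition of \<open>partition_matrix\<close> treats covered and general partitions
  differently. Assuming that the matrix of \<open>\<sigma>\<close> is the product over its covered
  parts removes the difference: the part with interior \<open>\<sigma>\<close> then depends on
  \<open>\<sigma>\<close> only through \<open>partition_matrix V \<sigma>\<close>.\<close>

lemma partition_matrix_insert_aux:
  assumes "a < c" "c < b" "\<sigma> \<in> NC2 {Suc a..<c}" "\<rho> \<in> NC2 {Suc c..<b}"
    and \<sigma>: "partition_matrix V \<sigma> = mat_product s (map (partition_matrix V) (covered_parts \<sigma>))"
      "partition_matrix V \<sigma> = mat_diag s f"
    and \<rho>: "partition_matrix V \<rho> = mat_product s (map (partition_matrix V) (covered_parts \<rho>))"
      "partition_matrix V \<rho> = mat_diag s g"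
  defines "\<pi> \<equiv> insert {a, c} (\<sigma> \<union> \<rho>)"
  shows "partition_matrix V \<pi> = mat_diag s (\<lambda>i. (\<Sum>j<s. f j * V $$ (j, i)) * g i)" (is "_ = ?M")
    and "partition_matrix V \<pi> = mat_product s (map (partition_matrix V) (covered_parts \<pi>))"
proof -
  have dim: "dim_row V = s" using V by simp
  let ?C = "insert {a, c} \<sigma>"
  have nc: "\<exists>a b. ?C \<in> NC2 {a..<b}"
    using covered_insert(1)[OF assms(1,3)] by (metis atLeastLessThanSuc_atLeastAtMost)
  have one: "mat_product s [] = 1\<^sub>m s" by (simp add: mat_product_def)
  have C: "partition_matrix V ?C = mat_diag s (\<lambda>i. \<Sum>j<s. f j * V $$ (j, i))"
  proof -
    \<comment> \<open>For empty \<open>\<sigma>\<close> the matrix is the identity, so the one-block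
      branch obeys the same formula.\<close>
    have "partition_matrix V ?C = column_sum_diag (partition_matrix V \<sigma> * V)"
      using nc covered_insert(2)[OF assms(1,3)] card_insert_eq_1[OF assms(1,3)] \<sigma>(1) dim V one
      by (subst partition_matrix.simps)
         (simp add: inner_parts_insert[OF assms(1,3)] partition_matrix_empty)
    then show ?thesis unfolding \<sigma>(2) column_sum_diag_mult[OF V] .
  qed
  have parts: "covered_parts \<pi> = ?C # covered_parts \<rho>"
    unfolding \<pi>_def using assms(1-4) by (rule covered_parts_insert)
  have prod: "mat_product s (map (partition_matrix V) (covered_parts \<pi>)) = ?M"
  proof -
    have "mat_product s (map (partition_matrix V) (covered_parts \<rho>)) = mat_diag s g"
      using \<rho> by simp
    then show ?thesis using C by (simp add: parts mat_product_def)
  qed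
  \<comment> \<open>If \<open>\<rho>\<close> is empty, \<open>\<pi>\<close> is covered and the
    product has a single factor; otherwise there are at least two parts and the definition is the
    product itself.\<close>
  have "partition_matrix V \<pi> = ?M"
  proof (cases "\<rho> = {}")
    case True
    then have "\<pi> = ?C" by (simp add: \<pi>_def)
    then show ?thesis using prod C parts True
      by (simp add: mat_product_def right_mult_one_mat[OF mat_diag_dim])
  next
    case False
    have "covered_decomposition \<rho> (covered_parts \<rho>)" using assms(4) by (rule covered_parts)
    then have "covered_parts \<rho> \<noteq> []" using False by (auto simp: covered_decomposition_def)
    then have "\<not> covered \<pi>" using covered_parts_covered[of \<pi>] parts by auto
    moreover have "\<exists>a b. \<pi> \<in> NC2 {a..<b}" using NC2_insert[OF assms(1-4)] \<pi>_def by blast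
    ultimately show ?thesis using prod dim by (subst partition_matrix.simps) simp
  qed
  then show "partition_matrix V \<pi> = ?M"
    "partition_matrix V \<pi> = mat_product s (map (partition_matrix V) (covered_parts \<pi>))"
    using prod by auto
qed

text \<open>Product formula and diagonality are proved together, since each induction step uses both
  for the two smaller partitions.\<close>

lemma partition_matrix_diag:
  assumes "\<pi> \<in> NC2 {a..<b}"
  shows "partition_matrix V \<pi> = mat_product s (map (partition_matrix V) (covered_parts \<pi>)) \<and>
    partition_matrix V \<pi> = mat_diag s (\<lambda>i. partition_matrix V \<pi> $$ (i, i))"
  using assms
proof (induction "b - a" arbitrary: a b \<pi> rule: less_induct)
  case less
  show ?case
  proof (cases "a < b")
    case False
    then have "\<pi> = {}" using less.prems by simp
    then show ?thesis
      using V by (auto simp: partition_matrix_empty mat_product_def mat_diag_def intro!: eq_matI)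
  next
    case True
    with less.prems obtain c \<sigma> \<rho> where c: "a < c" "c < b" "\<sigma> \<in> NC2 {Suc a..<c}" "\<rho> \<in> NC2 {Suc c..<b}"
      and \<pi>: "\<pi> = insert {a, c} (\<sigma> \<union> \<rho>)" by (rule NC2_split)
    have "c - Suc a < b - a" "b - Suc c < b - a" using c by auto
    from less.hyps[OF this(1) c(3)] less.hyps[OF this(2) c(4)]
    have "partition_matrix V \<pi> = mat_diag s (\<lambda>i.
        (\<Sum>j<s. partition_matrix V \<sigma> $$ (j, j) * V $$ (j, i)) * partition_matrix V \<rho> $$ (i, i))"
      "partition_matrix V \<pi> = mat_product s (map (partition_matrix V) (covered_parts \<pi>))"
      unfolding \<pi> by (intro partition_matrix_insert_aux[OF c(1-4)]; blast)+
    then show ?thesis by (auto simp: mat_diag_def intro!: eq_matI)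
  qed
qed

lemma partition_matrix_insert:
  assumes "a < c" "c < b" "\<sigma> \<in> NC2 {Suc a..<c}" "\<rho> \<in> NC2 {Suc c..<b}" "i < s"
  shows "partition_matrix V (insert {a, c} (\<sigma> \<union> \<rho>)) $$ (i, i) =
    (\<Sum>j<s. partition_matrix V \<sigma> $$ (j, j) * V $$ (j, i)) * partition_matrix V \<rho> $$ (i, i)"
  using partition_matrix_insert_aux(1)[OF assms(1-4)] partition_matrix_diag[OF assms(3)]
    partition_matrix_diag[OF assms(4)] assms(5)
  by (auto simp: mat_diag_def)

lemma v0_empty: "v0 V {} = 1"
  by (simp add: v0_def)

text \<open>With \<open>diagonal_part V\<close> in place of \<open>V\<close> the column sums
  collapse to single entries. The trace then sums over the colour of each outer block separately,
  whereas in \<open>partition_matrix_insert\<close> the colour \<open>i\<close> is shared with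
  \<open>\<rho>\<close>.\<close>

lemma v0_insert:
  assumes "a < c" "c < b" "\<sigma> \<in> NC2 {Suc a..<c}" "\<rho> \<in> NC2 {Suc c..<b}"
  shows "v0 V (insert {a, c} (\<sigma> \<union> \<rho>)) =
    (\<Sum>i<s. partition_matrix V \<sigma> $$ (i, i) * V $$ (i, i)) * v0 V \<rho>"
proof -
  let ?C = "insert {a, c} \<sigma>" and ?f = "\<lambda>i. partition_matrix V \<sigma> $$ (i, i)"
  have dim: "dim_row V = s" "dim_col V = s" using V by auto
  have D: "diagonal_part V \<in> carrier_mat s s"
    "\<And>i j. i < s \<Longrightarrow> j < s \<Longrightarrow> diagonal_part V $$ (i, j) = (if i = j then V $$ (j, j) else 0)"
    using dim by (auto simp: diagonal_part_def mat_diag_def)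
  have "covered_matrix0 V ?C = column_sum_diag (partition_matrix V \<sigma> * diagonal_part V)"
  proof (cases "\<sigma> = {}")
    case True
    \<comment> \<open>This fits the one-block case into the general formula.\<close>
    have "column_sum_diag (diagonal_part V) = diagonal_part V"
      using D(1) dim by (auto simp: column_sum_diag_def mat_diag_def diagonal_part_def intro!: eq_matI sum.delta)
    then show ?thesis
      using card_insert_eq_1[OF assms(1,3)] True D by (simp add: covered_matrix0_def partition_matrix_empty dim)
  next
    case False
    then show ?thesis
      using card_insert_eq_1[OF assms(1,3)] partition_matrix_diag[OF assms(3)]
      by (simp add: covered_matrix0_def inner_parts_insert[OF assms(1,3)] dim)
  qed
  also have "\<dots> = column_sum_diag (mat_diag s ?f * diagonal_part V)"
    using partition_matrix_diag[OF assms(3)] by metis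
  also have "\<dots> = mat_diag s (\<lambda>i. ?f i * V $$ (i, i))"
    unfolding column_sum_diag_mult[OF D(1)]
    by (auto simp: mat_diag_def D(2) if_distrib sum.delta cong: if_cong intro!: eq_matI)
  finally have "mat_trace (covered_matrix0 V ?C) = (\<Sum>i<s. ?f i * V $$ (i, i))"
    by (simp add: mat_trace_def mat_diag_def)
  then show ?thesis
    by (simp add: v0_def covered_parts_insert[OF assms])
qed

section \<open>Sums over all partitions of an interval\<close>

lemma sum_partition_matrix_rec:
  assumes "i < s"
  shows "(\<Sum>\<pi>\<in>NC2 {a..<a + Suc k}. partition_matrix V \<pi> $$ (i, i)) =
    (\<Sum>l<k. (\<Sum>j<s. (\<Sum>\<sigma>\<in>NC2 {Suc a..<Suc a + l}. partition_matrix V \<sigma> $$ (j, j)) * V $$ (j, i)) *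
       (\<Sum>\<rho>\<in>NC2 {Suc (Suc a + l)..<Suc (Suc a + l) + (k - Suc l)}. partition_matrix V \<rho> $$ (i, i)))"
    (is "?l = ?r")
proof -
  let ?p = "\<lambda>\<pi> i. partition_matrix V \<pi> $$ (i, i)"
  have "?l = (\<Sum>c\<in>{Suc a..<a + Suc k}. \<Sum>\<sigma>\<in>NC2 {Suc a..<c}. \<Sum>\<rho>\<in>NC2 {Suc c..<a + Suc k}.
      (\<Sum>j<s. ?p \<sigma> j * V $$ (j, i)) * ?p \<rho> i)"
    by (subst sum_NC2, simp, intro sum.cong refl partition_matrix_insert) (auto simp: Suc_le_eq assms)
  also have "\<dots> = (\<Sum>c\<in>{Suc a..<a + Suc k}. (\<Sum>j<s. (\<Sum>\<sigma>\<in>NC2 {Suc a..<c}. ?p \<sigma> j) * V $$ (j, i)) *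
      (\<Sum>\<rho>\<in>NC2 {Suc c..<a + Suc k}. ?p \<rho> i))"
    by (simp only: sum_sum_mult_swap)
  \<comment> \<open>Here \<open>l\<close> counts the points under the first block and
    \<open>k - Suc l\<close> those to its right.\<close>
  also have "\<dots> = ?r"
    by (rule sum.reindex_bij_witness[of _ "\<lambda>l. Suc a + l" "\<lambda>c. c - Suc a"]) (auto simp: add.commute)
  finally show ?thesis .
qed

text \<open>The total weight of what can be nested inside a block of colour \<open>i\<close> on
  \<open>k\<close> points; for walks, of all excursions of \<open>k\<close> steps above a letter of
  block \<open>i\<close>.\<close>

definition interior_weight :: "nat \<Rightarrow> nat \<Rightarrow> real" where
  "interior_weight k i = (\<Sum>\<pi>\<in>NC2 {0..<k}. partition_matrix V \<pi> $$ (i, i))"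

text \<open>The recursion sees only the lengths of intervals, so the sums are translation invariant.
  This takes the place of relabelling partitions.\<close>

lemma sum_partition_matrix_shift:
  "i < s \<Longrightarrow> (\<Sum>\<pi>\<in>NC2 {a..<a + k}. partition_matrix V \<pi> $$ (i, i)) = interior_weight k i"
proof (induction k arbitrary: a i rule: less_induct)
  case (less k)
  show ?case
  proof (cases k)
    case 0
    then show ?thesis by (simp add: interior_weight_def)
  next
    case (Suc k')
    have "(\<Sum>\<pi>\<in>NC2 {a..<a + Suc k'}. partition_matrix V \<pi> $$ (i, i)) =
      (\<Sum>l<k'. (\<Sum>j<s. interior_weight l j * V $$ (j, i)) * interior_weight (k' - Suc l) i)" for a
      unfolding sum_partition_matrix_rec[OF less.prems]
      by (intro sum.cong arg_cong2[of _ _ _ _ "(*)"] refl less.IH) (use less.prems Suc in auto)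
    from this[of a] this[of 0] show ?thesis by (simp add: Suc interior_weight_def)
  qed
qed

lemma interior_weight_0: "i < s \<Longrightarrow> interior_weight 0 i = 1"
  using V by (simp add: interior_weight_def partition_matrix_empty)

lemma interior_weight_Suc:
  assumes "i < s"
  shows "interior_weight (Suc k) i =
    (\<Sum>l<k. (\<Sum>j<s. interior_weight l j * V $$ (j, i)) * interior_weight (k - Suc l) i)"
proof -
  have "interior_weight (Suc k) i = (\<Sum>\<pi>\<in>NC2 {0..<0 + Suc k}. partition_matrix V \<pi> $$ (i, i))"
    by (simp add: interior_weight_def)
  also have "\<dots> = (\<Sum>l<k. (\<Sum>j<s. interior_weight l j * V $$ (j, i)) * interior_weight (k - Suc l) i)"
    unfolding sum_partition_matrix_rec[OF assms]
    by (intro sum.cong arg_cong2[of _ _ _ _ "(*)"] refl sum_partition_matrix_shift) (use assms in auto)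
  finally show ?thesis .
qed

lemma sum_v0_Suc:
  "(\<Sum>\<pi>\<in>NC2 {a..<a + Suc k}. v0 V \<pi>) =
    (\<Sum>l<k. (\<Sum>i<s. interior_weight l i * V $$ (i, i)) *
       (\<Sum>\<rho>\<in>NC2 {Suc (Suc a + l)..<Suc (Suc a + l) + (k - Suc l)}. v0 V \<rho>))"
    (is "?l = ?r")
proof -
  let ?p = "\<lambda>\<pi> i. partition_matrix V \<pi> $$ (i, i)"
  have "?l = (\<Sum>c\<in>{Suc a..<a + Suc k}. \<Sum>\<sigma>\<in>NC2 {Suc a..<c}. \<Sum>\<rho>\<in>NC2 {Suc c..<a + Suc k}.
      (\<Sum>i<s. ?p \<sigma> i * V $$ (i, i)) * v0 V \<rho>)"
    by (subst sum_NC2, simp, intro sum.cong refl v0_insert) (auto simp: Suc_le_eq)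
  also have "\<dots> = (\<Sum>c\<in>{Suc a..<a + Suc k}. (\<Sum>i<s. (\<Sum>\<sigma>\<in>NC2 {Suc a..<c}. ?p \<sigma> i) * V $$ (i, i)) *
      (\<Sum>\<rho>\<in>NC2 {Suc c..<a + Suc k}. v0 V \<rho>))"
    by (simp only: sum_sum_mult_swap)
  also have "\<dots> = (\<Sum>l<k. (\<Sum>i<s. (\<Sum>\<sigma>\<in>NC2 {Suc a..<Suc a + l}. ?p \<sigma> i) * V $$ (i, i)) *
      (\<Sum>\<rho>\<in>NC2 {Suc (Suc a + l)..<Suc (Suc a + l) + (k - Suc l)}. v0 V \<rho>))"
    by (rule sum.reindex_bij_witness[of _ "\<lambda>l. Suc a + l" "\<lambda>c. c - Suc a"]) (auto simp: add.commute)
  also have "\<dots> = ?r"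
    by (intro sum.cong arg_cong2[of _ _ _ _ "(*)"] refl sum_partition_matrix_shift) auto
  finally show ?thesis .
qed

end


section \<open>Dyck walks\<close>

definition below :: "'a \<Rightarrow> 'a list \<Rightarrow> 'a" where
  "below x xs = (case xs of [] \<Rightarrow> x | y # _ \<Rightarrow> y)"

lemma below_simps [simp]: "below x [] = x" "below x (y # ys) = y"
  by (simp_all add: below_def)

lemma below_map: "below (f x) (map f xs) = f (below x xs)"
  by (cases xs) auto

text \<open>
  The weight of all walks of \<open>m\<close> steps that empty the stack \<open>bs\<close> of blocks, the top being
  the head of the list. Popping \<open>b\<close> costs \<open>U\<^bsub>b,b'\<^esub>\<close>, where \<open>b'\<close> lies below \<open>b\<close>; the bottom element plays
  the role of its own lower neighbour, as the last index pair of a matricial word is diagonal.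
\<close>

fun stack_weight :: "nat \<Rightarrow> (nat \<Rightarrow> real) \<Rightarrow> real mat \<Rightarrow> nat \<Rightarrow> nat list \<Rightarrow> real" where
  "stack_weight r d U 0 bs = (if bs = [] then 1 else 0)"
| "stack_weight r d U (Suc m) bs = (\<Sum>b<r. d b * stack_weight r d U m (b # bs)) +
     (case bs of [] \<Rightarrow> 0 | b # bs' \<Rightarrow> U $$ (b, below b bs') * stack_weight r d U m bs')"

text \<open>Regroups a double sum by the total \<open>k + l + 1\<close>, the length of an excursion
  made of a first return and a remainder.\<close>

lemma sum_triangle_shift:
  fixes f :: "nat \<Rightarrow> nat \<Rightarrow> 'b :: comm_monoid_add"
  shows "(\<Sum>k<m. \<Sum>l\<le>m - Suc k. f k l) = (\<Sum>k\<le>m. \<Sum>l<k. f l (k - Suc l))"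
  unfolding sum.Sigma[OF finite_lessThan ballI[OF finite_atMost]]
    sum.Sigma[OF finite_atMost ballI[OF finite_lessThan]]
  by (rule sum.reindex_bij_witness[of _ "\<lambda>(k, l). (l, k - Suc l)" "\<lambda>(k, l). (Suc (k + l), k)"]) auto

context
  fixes r :: nat and d :: "nat \<Rightarrow> real" and U :: "real mat"
  assumes U: "U \<in> carrier_mat r r"
begin

abbreviation (input) "DU \<equiv> mat_diag r d * U"

lemma DU_carrier: "DU \<in> carrier_mat r r"
  by (rule mult_carrier_mat[OF mat_diag_dim U])

lemma DU_entry: "i < r \<Longrightarrow> j < r \<Longrightarrow> DU $$ (i, j) = d i * U $$ (i, j)"
  using U by (subst mat_diag_mult_left) auto

text \<open>Decomposition at the first step after which the top element \<open>b\<close> has been popped.\<close>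

lemma stack_weight_Cons:
  assumes "b < r"
  shows "stack_weight r d U (Suc m) (b # bs) =
    U $$ (b, below b bs) * (\<Sum>k\<le>m. interior_weight DU k b * stack_weight r d U (m - k) bs)"
  using assms
proof (induction m arbitrary: b bs rule: less_induct)
  case (less m)
  let ?A = "interior_weight DU" and ?w = "stack_weight r d U" and ?u = "U $$ (b, below b bs)"
  note A0 = interior_weight_0[OF DU_carrier less.prems]
  show ?case
  proof (cases m)
    case 0
    then show ?thesis using A0 by simp
  next
    case (Suc n)
    define T where "T k = (\<Sum>j<r. ?A k j * DU $$ (j, b))" for k
    \<comment> \<open>The induction hypothesis is applied to the letter \<open>j\<close> on top of
      \<open>b\<close>: popping it costs \<open>U $$ (j, b)\<close>, which together with
      \<open>d j\<close> is the entry of \<open>DU\<close>.\<close>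
    have push: "d j * ?w m (j # b # bs) = (\<Sum>k<n. ?A k j * DU $$ (j, b) * ?w (n - k) (b # bs))"
      if j: "j < r" for j
    proof -
      have "?w m (j # b # bs) = U $$ (j, b) * (\<Sum>k\<le>n. ?A k j * ?w (n - k) (b # bs))"
        using less.IH[of n j "b # bs"] Suc j by simp
      \<comment> \<open>The term \<open>k = n\<close> vanishes: no step is left while
        \<open>b\<close> is still on the stack.\<close>
      also have "(\<Sum>k\<le>n. ?A k j * ?w (n - k) (b # bs)) = (\<Sum>k<n. ?A k j * ?w (n - k) (b # bs))"
        by (simp add: lessThan_Suc_atMost[symmetric])
      finally show ?thesis
        using DU_entry[OF j less.prems] by (simp add: sum_distrib_left mult_ac)
    qed
    have pop: "?w (n - k) (b # bs) = ?u * (\<Sum>l\<le>n - Suc k. ?A l b * ?w (n - Suc k - l) bs)"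
      if "k < n" for k
    proof -
      have "n - k = Suc (n - Suc k)" using that by simp
      then show ?thesis using less.IH[of "n - Suc k" b bs] less.prems Suc that by simp
    qed
    have "(\<Sum>j<r. d j * ?w m (j # b # bs)) = (\<Sum>j<r. \<Sum>k<n. ?A k j * DU $$ (j, b) * ?w (n - k) (b # bs))"
      by (rule sum.cong[OF refl], rule push) simp
    also have "\<dots> = (\<Sum>k<n. T k * ?w (n - k) (b # bs))"
      by (subst sum.swap) (simp add: T_def sum_distrib_right)
    also have "\<dots> = (\<Sum>k<n. T k * (?u * (\<Sum>l\<le>n - Suc k. ?A l b * ?w (n - Suc k - l) bs)))"
      by (rule sum.cong[OF refl]) (simp only: pop lessThan_iff)
    also have "\<dots> = ?u * (\<Sum>k<n. \<Sum>l\<le>n - Suc k. T k * ?A l b * ?w (n - Suc k - l) bs)"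
      by (simp add: sum_distrib_left mult_ac)
    also have "(\<Sum>k<n. \<Sum>l\<le>n - Suc k. T k * ?A l b * ?w (n - Suc k - l) bs) =
        (\<Sum>k\<le>n. \<Sum>l<k. T l * ?A (k - Suc l) b * ?w (n - Suc l - (k - Suc l)) bs)"
      by (rule sum_triangle_shift)
    also have "\<dots> = (\<Sum>k\<le>n. ?A (Suc k) b * ?w (n - k) bs)"
      by (rule sum.cong[OF refl])
         (simp add: interior_weight_Suc[OF DU_carrier less.prems] T_def sum_distrib_right)
    finally have "?w (Suc m) (b # bs) = ?u * ((\<Sum>k\<le>n. ?A (Suc k) b * ?w (n - k) bs) + ?w m bs)"
      by (simp add: distrib_left)
    \<comment> \<open>The immediate pop of \<open>b\<close> is the term \<open>k = 0\<close>, the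
      empty excursion having weight 1.\<close>
    also have "(\<Sum>k\<le>n. ?A (Suc k) b * ?w (n - k) bs) + ?w m bs = (\<Sum>k\<le>m. ?A k b * ?w (m - k) bs)"
      unfolding Suc sum.atMost_Suc_shift by (simp add: A0 add.commute)
    finally show ?thesis .
  qed
qed

text \<open>First return to the empty stack: the bottom letter \<open>b\<close> is its own lower
  neighbour, so its push and pop contribute the diagonal entry of \<open>DU\<close> that
  \<open>v0\<close> assigns to an outer block. As \<open>a\<close> is arbitrary, the induction
  hypothesis applies directly to the interval that remains.\<close>

lemma stack_weight_Nil: "stack_weight r d U m [] = (\<Sum>\<pi>\<in>NC2 {a..<a + m}. v0 DU \<pi>)"
proof (induction m arbitrary: a rule: less_induct)
  case (less m)
  let ?A = "interior_weight DU" and ?w = "stack_weight r d U"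
  show ?case
  proof (cases m)
    case 0
    then show ?thesis by (simp add: v0_empty[OF DU_carrier])
  next
    case (Suc n)
    have *: "(\<Sum>b<r. d b * ?w n [b]) = (\<Sum>l<n. (\<Sum>i<r. ?A l i * DU $$ (i, i)) * ?w (n - Suc l) [])"
    proof (cases n)
      case (Suc k)
      have "(\<Sum>b<r. d b * ?w n [b]) = (\<Sum>b<r. \<Sum>l\<le>k. ?A l b * DU $$ (b, b) * ?w (k - l) [])"
        unfolding Suc by (intro sum.cong refl)
          (simp only: stack_weight_Cons DU_entry lessThan_iff, simp add: sum_distrib_left mult_ac)
      also have "\<dots> = (\<Sum>l\<le>k. (\<Sum>i<r. ?A l i * DU $$ (i, i)) * ?w (k - l) [])"
        by (subst sum.swap) (simp add: sum_distrib_right)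
      finally show ?thesis by (simp add: Suc lessThan_Suc_atMost)
    qed simp
    have "?w m [] = (\<Sum>l<n. (\<Sum>i<r. ?A l i * DU $$ (i, i)) * ?w (n - Suc l) [])"
      using * Suc by simp
    also have "\<dots> = (\<Sum>\<pi>\<in>NC2 {a..<a + Suc n}. v0 DU \<pi>)"
      unfolding sum_v0_Suc[OF DU_carrier]
      by (intro sum.cong arg_cong2[of _ _ _ _ "(*)"] refl less.IH) (use Suc in auto)
    finally show ?thesis by (simp add: Suc)
  qed
qed

end


section \<open>Reduced words\<close>

fun index_pairs :: "'i list \<Rightarrow> ('i \<times> 'i) list" where
  "index_pairs [] = []"
| "index_pairs (i # is) = (i, below i is) # index_pairs is"

lemma map_fst_index_pairs [simp]: "map fst (index_pairs is) = is"
  by (induction "is") auto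

lemma zip_last_eq_index_pairs: "is \<noteq> [] \<Longrightarrow> zip is (tl is @ [last is]) = index_pairs is"
proof (induction "is")
  case (Cons i "is")
  then show ?case by (cases "is") auto
qed simp

lemma matricial_words_eq: "matricial_words = {index_pairs is | is. is \<noteq> [] \<and> distinct_adj (index_pairs is)}"
  unfolding matricial_words_def by (intro Collect_cong ex_cong1) (auto simp: zip_last_eq_index_pairs)

text \<open>A matricial chain is determined by its first indices, so prolonging it leaves just one
  second index for each first index. This cuts the choices for a push from \<open>n\<^sup>2\<close>
  to \<open>n\<close>.\<close>

lemma Cons_in_matricial_words_iff:
  assumes "distinct_adj (p # index_pairs is)"
  shows "p # index_pairs is \<in> matricial_words \<longleftrightarrow> snd p = below (fst p) is"
proof
  assume "p # index_pairs is \<in> matricial_words"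
  then obtain js where js: "p # index_pairs is = index_pairs js" by (auto simp: matricial_words_eq)
  then have "js = fst p # is" by (metis map_fst_index_pairs list.simps(9))
  then have "p = (fst p, below (fst p) is)" using js by simp
  then show "snd p = below (fst p) is" by (metis snd_conv)
next
  assume "snd p = below (fst p) is"
  then have "p # index_pairs is = index_pairs (fst p # is)" by (cases p) auto
  then show "p # index_pairs is \<in> matricial_words"
    using assms unfolding matricial_words_eq by (metis (mono_tags, lifting) list.discI mem_Collect_eq)
qed

lemma below_in: "i \<in> I \<Longrightarrow> set is \<subseteq> I \<Longrightarrow> below i is \<in> I"
  by (cases "is") auto

section \<open>The algebra of a single matricially free array\<close>

locale matricially_free_array = unital_star_algebra A
  for A :: "'a star_algebra" (structure) +
  fixes I :: "'i set" and \<phi> :: "'a \<Rightarrow> complex" and \<psi> :: "'i \<Rightarrow> 'a \<Rightarrow> complex"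
    and X e :: "'i \<Rightarrow> 'i \<Rightarrow> 'a"
  assumes finite_I: "finite I" and I_nonempty: "I \<noteq> {}"
    and free: "matricially_free A I \<phi> \<psi> (\<lambda>i j. nonunital_subalgebra A hull {X i j, e i j}) e"
    and X_closed: "i \<in> I \<Longrightarrow> j \<in> I \<Longrightarrow> X i j \<in> carrier A"
    and centered: "i \<in> I \<Longrightarrow> j \<in> I \<Longrightarrow> state_array \<phi> \<psi> i j (X i j) = 0"
begin

abbreviation "\<AA> i j \<equiv> nonunital_subalgebra A hull {X i j, e i j}"
abbreviation "\<kappa> \<equiv> state_array \<phi> \<psi>"

lemma array: "algebra_array A I \<phi> \<psi> \<AA> e"
  and units: "matricially_free_units A I \<phi> \<psi> \<AA> e"
  and kernel_product: "ps \<noteq> [] \<Longrightarrow> kernel_sequence I \<phi> \<psi> \<AA> ps as \<Longrightarrow> distinct_adj ps \<Longrightarrow>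
    \<phi> (list_product A as) = 0"
  using free by (auto simp: matricially_free_def)

lemma state_\<phi>: "state A \<phi>" and state_\<psi>: "j \<in> I \<Longrightarrow> state A (\<psi> j)"
  using array by (auto simp: algebra_array_def)

lemma state_\<kappa>: "j \<in> I \<Longrightarrow> state A (\<kappa> i j)"
  using state_\<phi> state_\<psi> by (simp add: state_array_def)

lemma \<kappa>_unit: "i \<in> I \<Longrightarrow> j \<in> I \<Longrightarrow> \<kappa> i j (e i j) = 1"
  using array by (auto simp: algebra_array_def state_array_def)

lemma \<phi>_unit: "i \<in> I \<Longrightarrow> j \<in> I \<Longrightarrow> \<phi> (e i j) = (if i = j then 1 else 0)"
  using array by (auto simp: algebra_array_def)

lemma \<phi>_add: "x \<in> carrier A \<Longrightarrow> y \<in> carrier A \<Longrightarrow> \<phi> (x \<oplus> y) = \<phi> x + \<phi> y"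
  and \<phi>_smult: "x \<in> carrier A \<Longrightarrow> \<phi> (c \<odot>\<^bsub>A\<^esub> x) = c * \<phi> x"
  and \<phi>_one: "\<phi> \<one> = 1"
  using state_\<phi> by (simp_all add: state_def)

lemma scalar_closed: "x \<in> carrier A \<Longrightarrow> c \<odot>\<^bsub>A\<^esub> x \<in> carrier A"
  by simp

lemma zero_smult: "x \<in> carrier A \<Longrightarrow> 0 \<odot>\<^bsub>A\<^esub> x = \<zero>"
  using smult_l_null[of x] unfolding ring.select_convs .

context
  fixes i j assumes ij: "i \<in> I" "j \<in> I"
begin

text \<open>That the hull is itself a subalgebra is part of \<open>algebra_array\<close>, so closure
  of subalgebras under intersections need not be shown.\<close>

lemma subalgebra: "nonunital_subalgebra A (\<AA> i j)"
  using array ij by (simp add: algebra_array_def star_subalgebra_def)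

lemma subalgebra_closed:
  "x \<in> \<AA> i j \<Longrightarrow> x \<in> carrier A"
  "x \<in> \<AA> i j \<Longrightarrow> y \<in> \<AA> i j \<Longrightarrow> x \<oplus> y \<in> \<AA> i j"
  "x \<in> \<AA> i j \<Longrightarrow> y \<in> \<AA> i j \<Longrightarrow> x \<otimes> y \<in> \<AA> i j"
  "x \<in> \<AA> i j \<Longrightarrow> c \<odot>\<^bsub>A\<^esub> x \<in> \<AA> i j"
proof -
  have sub: "Module.submodule (\<AA> i j) (class_ring :: complex ring) A"
    using subalgebra by (simp add: nonunital_subalgebra_def)
  show "x \<in> \<AA> i j \<Longrightarrow> x \<in> carrier A" using submoduleE(1)[OF sub] by auto
  show "x \<in> \<AA> i j \<Longrightarrow> y \<in> \<AA> i j \<Longrightarrow> x \<oplus> y \<in> \<AA> i j" by (rule submoduleE(5)[OF sub])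
  show "x \<in> \<AA> i j \<Longrightarrow> c \<odot>\<^bsub>A\<^esub> x \<in> \<AA> i j" by (rule submoduleE(4)[OF sub]) simp
  show "x \<in> \<AA> i j \<Longrightarrow> y \<in> \<AA> i j \<Longrightarrow> x \<otimes> y \<in> \<AA> i j"
    using subalgebra by (simp add: nonunital_subalgebra_def)
qed

lemma X_in: "X i j \<in> \<AA> i j" and e_in: "e i j \<in> \<AA> i j"
  using hull_subset[of "{X i j, e i j}" "nonunital_subalgebra A"] by auto

lemma e_closed: "e i j \<in> carrier A"
  using e_in by (rule subalgebra_closed(1))

lemma e_left: "x \<in> \<AA> i j \<Longrightarrow> e i j \<otimes> x = x"
  and e_right: "x \<in> \<AA> i j \<Longrightarrow> x \<otimes> e i j = x"
  using array ij by (simp_all add: algebra_array_def internal_unit_def)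

lemma e_in_unit_algebra: "e i j \<in> unit_algebra A I e"
  unfolding unit_algebra_def by (rule hull_inc) (use ij in blast)

lemma X_power_in: "X i j [^] Suc k \<in> \<AA> i j"
  by (induction k) (use X_in subalgebra_closed ij X_closed in \<open>auto\<close>)

end

section \<open>Moments and centered powers\<close>

definition moment :: "'i \<Rightarrow> 'i \<Rightarrow> nat \<Rightarrow> complex" where
  "moment i j k = \<kappa> i j (X i j [^] k)"

definition centered_power :: "'i \<Rightarrow> 'i \<Rightarrow> nat \<Rightarrow> 'a" where
  "centered_power i j k = X i j [^] k \<oplus> (- moment i j k) \<odot>\<^bsub>A\<^esub> e i j"

text \<open>Positivity of \<open>k\<close> matters: \<open>X i j [^] 0\<close> is the unit of
  \<open>A\<close>, which need not lie in the subalgebra.\<close>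

lemma centered_power_in:
  assumes "i \<in> I" "j \<in> I" "0 < k"
  shows "centered_power i j k \<in> \<AA> i j"
proof -
  obtain l where "k = Suc l" using assms(3) gr0_implies_Suc by blast
  then show ?thesis
    using assms X_power_in e_in subalgebra_closed by (simp add: centered_power_def del: nat_pow_Suc)
qed

lemma centered_power_closed: "i \<in> I \<Longrightarrow> j \<in> I \<Longrightarrow> 0 < k \<Longrightarrow> centered_power i j k \<in> carrier A"
  using centered_power_in subalgebra_closed(1) by blast

lemma centered_power_kernel:
  assumes "i \<in> I" "j \<in> I"
  shows "\<kappa> i j (centered_power i j k) = 0"
  using state_\<kappa>[OF assms(2), of i] \<kappa>_unit[OF assms] e_closed[OF assms] X_closed[OF assms]
  by (simp add: centered_power_def state_def moment_def)

lemma moment_1: "i \<in> I \<Longrightarrow> j \<in> I \<Longrightarrow> moment i j (Suc 0) = 0"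
  using centered X_closed by (simp add: moment_def)

lemma centered_power_1: "i \<in> I \<Longrightarrow> j \<in> I \<Longrightarrow> centered_power i j (Suc 0) = X i j"
  using e_closed X_closed by (simp add: centered_power_def moment_1 zero_smult)

lemma X_power_eq:
  assumes "i \<in> I" "j \<in> I"
  shows "X i j [^] k = centered_power i j k \<oplus> moment i j k \<odot>\<^bsub>A\<^esub> e i j"
proof -
  have e: "e i j \<in> carrier A" and x: "X i j [^] k \<in> carrier A" using e_closed X_closed assms by auto
  have "(- moment i j k) \<odot>\<^bsub>A\<^esub> e i j \<oplus> moment i j k \<odot>\<^bsub>A\<^esub> e i j = \<zero>"
    using smult_l_distr[of "- moment i j k" "moment i j k" "e i j"] e by (simp add: zero_smult)
  then show ?thesis using e x by (simp add: centered_power_def a_assoc scalar_closed)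
qed

text \<open>As \<open>e i j\<close> is a unit for \<open>X i j\<close>, the product is the next
  power minus \<open>moment i j k\<close> times \<open>X i j\<close>. Centering the next power
  yields the three outcomes: raise, pop and reset.\<close>

lemma X_mult_centered_power:
  assumes "i \<in> I" "j \<in> I" "0 < k"
  shows "X i j \<otimes> centered_power i j k =
    centered_power i j (Suc k) \<oplus> moment i j (Suc k) \<odot>\<^bsub>A\<^esub> e i j \<oplus> (- moment i j k) \<odot>\<^bsub>A\<^esub> centered_power i j (Suc 0)"
proof -
  have e: "e i j \<in> carrier A" and x: "X i j \<in> carrier A" using e_closed X_closed assms by auto
  have "X i j \<otimes> centered_power i j k =
    X i j \<otimes> (X i j [^] k) \<oplus> (- moment i j k) \<odot>\<^bsub>A\<^esub> (X i j \<otimes> e i j)"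
    using e x by (simp add: centered_power_def r_distr smult_mult_right)
  also have "X i j \<otimes> (X i j [^] k) = X i j [^] Suc k"
    using x nat_pow_Suc2[of "X i j" k] by simp
  also have "X i j \<otimes> e i j = X i j"
    using assms X_in e_right by blast
  finally show ?thesis
    unfolding centered_power_1[OF assms(1,2)] X_power_eq[OF assms(1,2), symmetric] .
qed

section \<open>Words encoded by stacks\<close>

fun letters :: "('i \<times> nat) list \<Rightarrow> 'a list" where
  "letters [] = []"
| "letters ((i, k) # s) = centered_power i (below i (map fst s)) k # letters s"

definition word :: "('i \<times> nat) list \<Rightarrow> 'a" where
  "word s = list_product A (letters s)"

definition admissible :: "('i \<times> nat) list \<Rightarrow> bool" where
  "admissible s \<longleftrightarrow> distinct_adj (index_pairs (map fst s)) \<and> set (map fst s) \<subseteq> I \<and> (\<forall>(i, k)\<in>set s. 0 < k)"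

lemma word_simps:
  "word [] = \<one>" "word ((i, k) # s) = centered_power i (below i (map fst s)) k \<otimes> word s"
  by (simp_all add: word_def list_product_def)

lemma admissible_Cons:
  "admissible ((i, k) # s) \<longleftrightarrow>
     admissible s \<and> i \<in> I \<and> 0 < k \<and> distinct_adj ((i, below i (map fst s)) # index_pairs (map fst s))"
  by (auto simp: admissible_def distinct_adj_Cons)

lemma admissible_Nil [simp]: "admissible []"
  by (simp add: admissible_def)

lemma admissible_below: "admissible s \<Longrightarrow> i \<in> I \<Longrightarrow> below i (map fst s) \<in> I"
  by (rule below_in) (auto simp: admissible_def)

lemma word_closed: "admissible s \<Longrightarrow> word s \<in> carrier A"
proof (induction s)
  case (Cons x s)
  then show ?case
    using admissible_below by (cases x) (auto simp: word_simps admissible_Cons intro!: centered_power_closed)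
qed (simp add: word_simps)

lemma kernel_sequence_letters:
  "admissible s \<Longrightarrow> kernel_sequence I \<phi> \<psi> \<AA> (index_pairs (map fst s)) (letters s)"
proof (induction s)
  case (Cons x s)
  obtain i k where x: "x = (i, k)" by (cases x)
  have i: "i \<in> I" "0 < k" "admissible s" using Cons.prems x by (auto simp: admissible_Cons)
  note b = admissible_below[OF i(3,1)]
  show ?case
    using Cons.IH i b centered_power_in[OF i(1) b i(2)] centered_power_kernel[OF i(1) b, of k]
    by (simp add: x kernel_sequence_def)
qed (simp add: kernel_sequence_def)

lemma \<phi>_word:
  assumes "admissible s"
  shows "\<phi> (word s) = (if s = [] then 1 else 0)"
proof (cases s)
  case Nil
  then show ?thesis by (simp add: word_simps \<phi>_one)
next
  case (Cons x s')
  then have "index_pairs (map fst s) \<noteq> []" by simp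
  then show ?thesis
    using kernel_product[OF _ kernel_sequence_letters[OF assms]] assms Cons
    by (simp add: word_def admissible_def)
qed

text \<open>Since \<open>\<phi> (u x u) = \<phi> x\<close> for \<open>u = 1\<^bsub>i,i\<^esub>\<close>, replacing \<open>x\<close> by \<open>u x\<close> gives \<open>\<phi> (u x) = \<phi> x\<close>.\<close>

lemma \<phi>_mult_unit:
  assumes "b \<in> carrier A" "i \<in> I" "j \<in> I"
  shows "\<phi> (b \<otimes> e i j) = (if i = j then \<phi> b else 0)"
proof -
  have bi: "\<phi> (u \<otimes> x \<otimes> w) = \<phi> u * \<phi> x * \<phi> w"
    if "x \<in> carrier A" "u \<in> unit_algebra A I e" "w \<in> unit_algebra A I e" for u x w
    using units that by (simp add: matricially_free_units_def)
  let ?u = "e i i"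
  note u = e_in_unit_algebra[OF assms(2,2)] e_closed[OF assms(2,2)]
  have "\<phi> (?u \<otimes> x) = \<phi> x" if x: "x \<in> carrier A" for x
  proof -
    have "\<phi> (?u \<otimes> x) = \<phi> (?u \<otimes> (?u \<otimes> x) \<otimes> ?u)"
      using bi[of "?u \<otimes> x" ?u ?u] x u \<phi>_unit[OF assms(2,2)] by simp
    also have "?u \<otimes> (?u \<otimes> x) = ?u \<otimes> x"
      using x u e_left[OF assms(2,2) e_in[OF assms(2,2)]] by (simp add: m_assoc[symmetric])
    also have "\<phi> (?u \<otimes> x \<otimes> ?u) = \<phi> x"
      using bi[of x ?u ?u] x u \<phi>_unit[OF assms(2,2)] by simp
    finally show ?thesis .
  qed
  from this[of "b \<otimes> e i j"] have "\<phi> (b \<otimes> e i j) = \<phi> (?u \<otimes> b \<otimes> e i j)"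
    using assms u e_closed[OF assms(2,3)] by (simp add: m_assoc)
  also have "\<dots> = \<phi> b * \<phi> (e i j)"
    using bi[of b ?u "e i j"] assms u e_in_unit_algebra[OF assms(2,3)] \<phi>_unit[OF assms(2,2)] by simp
  finally show ?thesis using \<phi>_unit[OF assms(2,3)] by simp
qed

text \<open>The freeness condition speaks of non-empty kernel sequences; the empty word is covered
  by \<open>\<phi>_mult_unit\<close>, where \<open>below i [] = i\<close> gives the condition the
  same form.\<close>

lemma \<phi>_mult_unit_word:
  assumes "b \<in> carrier A" "i \<in> I" "j \<in> I" "admissible s"
    and "distinct_adj ((i, j) # index_pairs (map fst s))"
  shows "\<phi> (b \<otimes> e i j \<otimes> word s) = (if j = below i (map fst s) then \<phi> (b \<otimes> word s) else 0)"
proof (cases "s = []")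
  case True
  then show ?thesis using \<phi>_mult_unit[OF assms(1-3)] assms e_closed by (simp add: word_simps)
next
  case False
  then have "index_pairs (map fst s) \<noteq> []" by (cases s) auto
  then have "\<phi> (b \<otimes> e i j \<otimes> word s) =
      (if (i, j) # index_pairs (map fst s) \<in> matricial_words then \<phi> (b \<otimes> word s) else 0)"
    using units assms kernel_sequence_letters[OF assms(4)]
    unfolding matricially_free_units_def word_def by blast
  then show ?thesis using Cons_in_matricial_words_iff[OF assms(5)] by simp
qed

section \<open>One-step recursion for mixed moments\<close>

definition total :: 'a where
  "total = finsum A (\<lambda>(i, j). X i j) (I \<times> I)"

definition mixed_moment :: "nat \<Rightarrow> ('i \<times> nat) list \<Rightarrow> complex" where
  "mixed_moment m s = \<phi> (total [^] m \<otimes> word s)"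

lemma total_closed: "total \<in> carrier A"
  unfolding total_def using X_closed by (auto intro!: finsum_closed)

lemma \<phi>_finsum:
  "finite P \<Longrightarrow> f \<in> P \<rightarrow> carrier A \<Longrightarrow> \<phi> (finsum A f P) = (\<Sum>p\<in>P. \<phi> (f p))"
proof (induction P rule: finite_induct)
  case empty
  have "\<phi> \<zero> = 0" using \<phi>_add[of \<zero> \<zero>] by simp
  then show ?case by simp
next
  case (insert p P)
  then have "f \<in> P \<rightarrow> carrier A" "f p \<in> carrier A" by auto
  then show ?case using insert by (simp add: finsum_insert \<phi>_add finsum_closed)
qed

lemma mixed_moment_0: "admissible s \<Longrightarrow> mixed_moment 0 s = (if s = [] then 1 else 0)"
  using \<phi>_word word_closed by (simp add: mixed_moment_def)

lemma mixed_moment_Suc_sum: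
  assumes "admissible s"
  shows "mixed_moment (Suc m) s = (\<Sum>(i, j)\<in>I \<times> I. \<phi> (total [^] m \<otimes> (X i j \<otimes> word s)))"
proof -
  let ?a = "total [^] m" and ?w = "word s"
  have a: "?a \<in> carrier A" and w: "?w \<in> carrier A" and f: "(\<lambda>(i, j). X i j) \<in> I \<times> I \<rightarrow> carrier A"
    using total_closed word_closed[OF assms] X_closed by auto
  have "mixed_moment (Suc m) s = \<phi> (?a \<otimes> (total \<otimes> ?w))"
    using a w total_closed by (simp add: mixed_moment_def m_assoc)
  also have "?a \<otimes> (total \<otimes> ?w) = finsum A (\<lambda>p. ?a \<otimes> ((\<lambda>(i, j). X i j) p \<otimes> ?w)) (I \<times> I)"
    unfolding total_def
    using a w f finite_I by (subst finsum_ldistr) (auto intro!: finsum_rdistr simp: X_closed)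
  also have "\<phi> \<dots> = (\<Sum>p\<in>I \<times> I. \<phi> (?a \<otimes> ((\<lambda>(i, j). X i j) p \<otimes> ?w)))"
    by (rule \<phi>_finsum) (use a w finite_I in \<open>auto simp: X_closed\<close>)
  finally show ?thesis by (simp add: case_prod_unfold)
qed

text \<open>Writing \<open>X i j\<close> as \<open>X i j \<otimes> e i j\<close> puts a unit in
  front of the word, and the unit annihilates every second index but one.\<close>

lemma mixed_moment_push:
  assumes "admissible s" "i \<in> I" "j \<in> I" "distinct_adj ((i, j) # index_pairs (map fst s))"
  shows "\<phi> (total [^] m \<otimes> (X i j \<otimes> word s)) =
    (if j = below i (map fst s) then mixed_moment m ((i, Suc 0) # s) else 0)"
proof -
  note x = X_closed[OF assms(2,3)] and e = e_closed[OF assms(2,3)] and w = word_closed[OF assms(1)]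
  have a: "total [^] m \<in> carrier A" using total_closed by simp
  have "X i j \<otimes> word s = X i j \<otimes> e i j \<otimes> word s"
    using e_right[OF assms(2,3) X_in[OF assms(2,3)]] by simp
  then have "\<phi> (total [^] m \<otimes> (X i j \<otimes> word s)) = \<phi> (total [^] m \<otimes> X i j \<otimes> e i j \<otimes> word s)"
    using x e w a by (simp add: m_assoc)
  also have "\<dots> = (if j = below i (map fst s) then \<phi> (total [^] m \<otimes> X i j \<otimes> word s) else 0)"
    using \<phi>_mult_unit_word[OF _ assms(2,3,1,4)] x a by simp
  finally show ?thesis
    using x w a centered_power_1[OF assms(2,3)] by (auto simp: mixed_moment_def word_simps m_assoc)
qed

lemma mixed_moment_pop:
  assumes "admissible ((i, k) # s)"
  defines "j \<equiv> below i (map fst s)"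
  shows "\<phi> (total [^] m \<otimes> (X i j \<otimes> word ((i, k) # s))) =
    mixed_moment m ((i, Suc k) # s) + moment i j (Suc k) * mixed_moment m s
      - moment i j k * mixed_moment m ((i, Suc 0) # s)"
proof -
  have s: "admissible s" "i \<in> I" "0 < k" "distinct_adj ((i, j) # index_pairs (map fst s))"
    using assms by (auto simp: admissible_Cons)
  have j: "j \<in> I" unfolding j_def by (rule admissible_below[OF s(1,2)])
  note x = X_closed[OF s(2) j] and e = e_closed[OF s(2) j] and w = word_closed[OF s(1)]
    and c = centered_power_closed[OF s(2) j]
  have a: "total [^] m \<in> carrier A" using total_closed by simp
  let ?c = "centered_power i j"
  have "X i j \<otimes> word ((i, k) # s) = (X i j \<otimes> ?c k) \<otimes> word s"
    using x c[OF s(3)] w by (simp add: word_simps j_def[symmetric] m_assoc)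
  also have "\<dots> = ?c (Suc k) \<otimes> word s \<oplus> moment i j (Suc k) \<odot>\<^bsub>A\<^esub> (e i j \<otimes> word s) \<oplus>
      (- moment i j k) \<odot>\<^bsub>A\<^esub> (?c (Suc 0) \<otimes> word s)"
    unfolding X_mult_centered_power[OF s(2) j s(3)]
    using c e w by (simp add: l_distr smult_mult_left)
  finally have "total [^] m \<otimes> (X i j \<otimes> word ((i, k) # s)) =
      total [^] m \<otimes> (?c (Suc k) \<otimes> word s) \<oplus> moment i j (Suc k) \<odot>\<^bsub>A\<^esub> (total [^] m \<otimes> e i j \<otimes> word s) \<oplus>
      (- moment i j k) \<odot>\<^bsub>A\<^esub> (total [^] m \<otimes> (?c (Suc 0) \<otimes> word s))"
    using a c e w by (simp add: r_distr smult_mult_right m_assoc)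
  then have "\<phi> (total [^] m \<otimes> (X i j \<otimes> word ((i, k) # s))) =
      \<phi> (total [^] m \<otimes> (?c (Suc k) \<otimes> word s)) + moment i j (Suc k) * \<phi> (total [^] m \<otimes> e i j \<otimes> word s)
      - moment i j k * \<phi> (total [^] m \<otimes> (?c (Suc 0) \<otimes> word s))"
    using a c e w by (simp add: \<phi>_add \<phi>_smult)
  \<comment> \<open>The unit freed by the moment term disappears, since \<open>j\<close> is the
    index that continues the chain.\<close>
  then show ?thesis
    using \<phi>_mult_unit_word[OF a s(2) j s(1,4)] by (simp add: mixed_moment_def word_simps j_def)
qed

definition pushable :: "('i \<times> nat) list \<Rightarrow> 'i set" where
  "pushable s = {i \<in> I. admissible ((i, Suc 0) # s)}"

text \<open>Only the index pair of the top letter multiplies within the algebra of that letter.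
  Every other pair keeps the word alternating and is a push or contributes 0.\<close>

lemma mixed_moment_Suc:
  assumes "admissible s"
  shows "mixed_moment (Suc m) s = (\<Sum>i\<in>pushable s. mixed_moment m ((i, Suc 0) # s)) +
    (case s of [] \<Rightarrow> 0 | (i, k) # t \<Rightarrow>
       mixed_moment m ((i, Suc k) # t) + moment i (below i (map fst t)) (Suc k) * mixed_moment m t
         - moment i (below i (map fst t)) k * mixed_moment m ((i, Suc 0) # t))"
    (is "_ = _ + ?c")
proof -
  let ?P = "{p \<in> I \<times> I. distinct_adj (p # index_pairs (map fst s))}"
  let ?f = "\<lambda>(i, j). \<phi> (total [^] m \<otimes> (X i j \<otimes> word s))"
  have "(\<Sum>p\<in>?P. ?f p) = (\<Sum>p\<in>?P. if snd p = below (fst p) (map fst s)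
      then mixed_moment m ((fst p, Suc 0) # s) else 0)"
    by (rule sum.cong) (auto simp: mixed_moment_push[OF assms])
  also have "\<dots> = (\<Sum>p\<in>{p\<in>?P. snd p = below (fst p) (map fst s)}. mixed_moment m ((fst p, Suc 0) # s))"
    using finite_I by (subst sum.inter_filter) auto
  also have "\<dots> = (\<Sum>i\<in>pushable s. mixed_moment m ((i, Suc 0) # s))"
    by (rule sum.reindex_bij_witness[of _ "\<lambda>i. (i, below i (map fst s))" fst])
       (auto simp: pushable_def admissible_Cons assms admissible_below[OF assms])
  finally have P: "(\<Sum>p\<in>?P. ?f p) = (\<Sum>i\<in>pushable s. mixed_moment m ((i, Suc 0) # s))" .
  have "(\<Sum>p\<in>I \<times> I - ?P. ?f p) = ?c"
  proof (cases s)
    case Nil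
    then have "I \<times> I - ?P = {}" by auto
    then show ?thesis using Nil by simp
  next
    case (Cons x t)
    obtain i k where x: "x = (i, k)" by (cases x)
    have s: "admissible ((i, k) # t)" using assms Cons x by simp
    then have i: "i \<in> I" "admissible t" by (auto simp: admissible_Cons)
    have P: "index_pairs (map fst s) = (i, below i (map fst t)) # index_pairs (map fst t)"
      using Cons x by simp
    have "distinct_adj (index_pairs (map fst s))"
      using assms by (simp add: admissible_def)
    then have "distinct_adj (p # index_pairs (map fst s)) \<longleftrightarrow> p \<noteq> (i, below i (map fst t))" for p
      unfolding P by simp
    then have "I \<times> I - ?P = {(i, below i (map fst t))}"
      using i(1) admissible_below[OF i(2,1)] by auto
    then show ?thesis using mixed_moment_pop[OF s] Cons x by simp
  qed
  moreover have "(\<Sum>p\<in>I \<times> I. ?f p) = (\<Sum>p\<in>I \<times> I - ?P. ?f p) + (\<Sum>p\<in>?P. ?f p)"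
    by (rule sum.subset_diff) (use finite_I in auto)
  ultimately show ?thesis using P mixed_moment_Suc_sum[OF assms, of m] by simp
qed

end


section \<open>Asymptotics\<close>

text \<open>With \<open>C\<close> and \<open>K\<close> for the two sums, pushes and the raise cost
  \<open>C\<close> each, pop and reset \<open>K * C\<close> each, in total
  \<open>2 * (1 + K) * C\<close>. A step increases the level by at most one and uses moments of
  order at most \<open>Suc L\<close>.\<close>

fun moment_bound :: "(nat \<Rightarrow> real) \<Rightarrow> nat \<Rightarrow> nat \<Rightarrow> real" where
  "moment_bound M 0 L = 1"
| "moment_bound M (Suc m) L = 2 * (1 + (\<Sum>k\<le>Suc L. M k)) * (\<Sum>l\<le>Suc L. moment_bound M m l)"

lemma moment_bound_nonneg: "(\<And>k. 0 \<le> M k) \<Longrightarrow> 0 \<le> moment_bound M m L"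
  by (induction M m L rule: moment_bound.induct) (auto intro!: mult_nonneg_nonneg sum_nonneg add_nonneg_nonneg)

definition level :: "('i \<times> nat) list \<Rightarrow> nat" where
  "level s = sum_list (map snd s)"

lemma level_simps [simp]: "level [] = 0" "level ((i, k) # s) = k + level s"
  by (simp_all add: level_def)

text \<open>The parameter \<open>t\<close> stands for \<open>n\<^sup>-\<^sup>1\<^sup>/\<^sup>2\<close>, where \<open>n\<close> is the number of indices.\<close>

locale scaled_array = matricially_free_array A I \<phi> \<psi> X e
  for A :: "'a star_algebra" (structure) and I :: "'i set" and \<phi> \<psi> X e +
  fixes t :: real and M :: "nat \<Rightarrow> real"
  assumes t_pos: "0 < t" and t_le: "t \<le> 1" and card_I: "real (card I) * t\<^sup>2 = 1"
    and M_nonneg: "0 \<le> M k"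
    and moment_le: "i \<in> I \<Longrightarrow> j \<in> I \<Longrightarrow> cmod (moment i j k) \<le> M k * t ^ k"
begin

text \<open>
  Emptying a stack of height \<open>h\<close> and level \<open>L\<close> in \<open>m\<close> steps allows at most \<open>(m - h) / 2\<close> pushes, whereas
  the moments contribute \<open>t\<^bsup>m + L\<^esup>\<close>; with \<open>n = t\<^sup>-\<^sup>2\<close> choices per push this leaves the exponent \<open>h + L\<close>.
\<close>

lemma norm_mixed_moment_le:
  "admissible s \<Longrightarrow> cmod (mixed_moment m s) \<le> moment_bound M m (level s) * t ^ (length s + level s)"
proof (induction m arbitrary: s)
  case 0
  then show ?case using t_pos by (auto simp: mixed_moment_0)
next
  case (Suc m)
  let ?L = "level s" and ?T = "t ^ (length s + level s)"
  let ?C = "\<Sum>l\<le>Suc ?L. moment_bound M m l" and ?K = "\<Sum>k\<le>Suc ?L. M k"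
  note nn = moment_bound_nonneg[of M, OF M_nonneg]
  have T: "0 \<le> ?T" using t_pos by simp
  have C: "moment_bound M m l \<le> ?C" if "l \<le> Suc ?L" for l
    using that nn by (intro member_le_sum) auto
  have K: "M k \<le> ?K" if "k \<le> Suc ?L" for k
    using that M_nonneg by (intro member_le_sum) auto
  have C0: "0 \<le> ?C" and K0: "0 \<le> ?K" by (intro sum_nonneg nn M_nonneg)+
  have bound: "cmod (mixed_moment m u) \<le> ?C * t ^ (length u + level u)"
    if "admissible u" "level u \<le> Suc ?L" for u
    by (rule order_trans[OF Suc.IH[OF that(1)] mult_right_mono[OF C[OF that(2)]]]) (use t_pos in simp)
  have push: "cmod (\<Sum>i\<in>pushable s. mixed_moment m ((i, Suc 0) # s)) \<le> ?C * ?T"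
  proof -
    \<comment> \<open>A push increases height and level by one each; the resulting factor
      \<open>t\<^sup>2\<close> pays for the choice of the index.\<close>
    have "cmod (\<Sum>i\<in>pushable s. mixed_moment m ((i, Suc 0) # s)) \<le> (\<Sum>i\<in>pushable s. ?C * (t\<^sup>2 * ?T))"
    proof (rule sum_norm_le)
      fix i assume "i \<in> pushable s"
      then have "admissible ((i, Suc 0) # s)" by (simp add: pushable_def)
      from bound[OF this] show "cmod (mixed_moment m ((i, Suc 0) # s)) \<le> ?C * (t\<^sup>2 * ?T)"
        by (simp add: power2_eq_square mult_ac)
    qed
    also have "\<dots> = real (card (pushable s)) * t\<^sup>2 * (?C * ?T)" by simp
    also have "\<dots> \<le> real (card I) * t\<^sup>2 * (?C * ?T)"
      using finite_I C0 T by (intro mult_right_mono) (auto simp: pushable_def intro!: card_mono)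
    finally show ?thesis using card_I by simp
  qed
  \<comment> \<open>The last condition says that the moment makes up for the lost exponent: exactly
    for a pop, with one power of \<open>t\<close> to spare for a reset.\<close>
  have step: "cmod (moment i j k * mixed_moment m u) \<le> ?K * (?C * ?T)"
    if "i \<in> I" "j \<in> I" "k \<le> Suc ?L" "admissible u" "level u \<le> Suc ?L"
      "length s + level s \<le> k + (length u + level u)" for i j k u
  proof -
    have "cmod (moment i j k * mixed_moment m u) \<le> (?K * t ^ k) * (?C * t ^ (length u + level u))"
      unfolding norm_mult
    proof (rule mult_mono)
      have "M k * t ^ k \<le> ?K * t ^ k" using K[OF that(3)] t_pos by (intro mult_right_mono) auto
      then show "cmod (moment i j k) \<le> ?K * t ^ k" using moment_le[OF that(1,2), of k] by simp
      show "cmod (mixed_moment m u) \<le> ?C * t ^ (length u + level u)" by (rule bound[OF that(4,5)])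
    qed (use K0 t_pos in auto)
    also have "\<dots> = ?K * ?C * t ^ (k + (length u + level u))" by (simp add: power_add)
    also have "\<dots> \<le> ?K * ?C * ?T"
      using that(6) K0 C0 t_pos t_le by (intro mult_left_mono power_decreasing) auto
    finally show ?thesis by simp
  qed
  show ?case
  proof (cases s)
    case Nil
    have "1 * ?C \<le> 2 * (1 + ?K) * ?C"
      using C0 K0 by (intro mult_right_mono) auto
    from mult_right_mono[OF this T] have "?C * ?T \<le> 2 * (1 + ?K) * ?C * ?T" by simp
    then show ?thesis using push Nil by (simp add: mixed_moment_Suc)
  next
    case (Cons x u)
    obtain i k where x: "x = (i, k)" by (cases x)
    let ?j = "below i (map fst u)"
    have s: "s = (i, k) # u" using Cons x by simp
    then have u: "admissible u" "i \<in> I" "0 < k" and ad: "\<And>l. 0 < l \<Longrightarrow> admissible ((i, l) # u)"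
      using Suc.prems by (auto simp: admissible_Cons)
    have j: "?j \<in> I" by (rule admissible_below[OF u(1,2)])
    have "cmod (mixed_moment m ((i, Suc k) # u)) \<le> ?C * t ^ Suc (length s + level s)"
      using bound[OF ad[of "Suc k"]] by (simp add: s)
    also have "\<dots> \<le> ?C * ?T" using C0 t_pos t_le by (intro mult_left_mono power_decreasing) auto
    finally have 1: "cmod (mixed_moment m ((i, Suc k) # u)) \<le> ?C * ?T" .
    have 2: "cmod (moment i ?j (Suc k) * mixed_moment m u) \<le> ?K * (?C * ?T)"
      by (rule step[OF u(2) j]) (use u s in auto)
    have 3: "cmod (moment i ?j k * mixed_moment m ((i, Suc 0) # u)) \<le> ?K * (?C * ?T)"
      by (rule step[OF u(2) j]) (use u s ad in auto)
    have "mixed_moment (Suc m) s = (\<Sum>i\<in>pushable s. mixed_moment m ((i, Suc 0) # s)) +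
        (mixed_moment m ((i, Suc k) # u) + moment i ?j (Suc k) * mixed_moment m u
         - moment i ?j k * mixed_moment m ((i, Suc 0) # u))"
      using mixed_moment_Suc[OF Suc.prems] by (simp add: s)
    also have "cmod \<dots> \<le> ?C * ?T + (?C * ?T + ?K * (?C * ?T) + ?K * (?C * ?T))"
      by (intro norm_triangle_le norm_triangle_le_diff add_mono push 1 2 3)
    also have "\<dots> = 2 * (1 + ?K) * ?C * ?T" by (simp add: algebra_simps)
    finally show ?thesis by simp
  qed
qed

text \<open>A push is blocked only if its pair repeats the top pair, which fixes its first index. On
  the empty stack nothing is blocked, so the unspecified \<open>hd []\<close> does no harm.\<close>

lemma card_not_pushable:
  assumes "admissible s"
  shows "card (I - pushable s) \<le> 1"
proof -
  have "I - pushable s \<subseteq> {fst (hd s)}"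
  proof
    fix i assume i: "i \<in> I - pushable s"
    then have "\<not> distinct_adj ((i, below i (map fst s)) # index_pairs (map fst s))"
      using assms by (auto simp: pushable_def admissible_Cons)
    then show "i \<in> {fst (hd s)}"
      using assms by (cases s) (auto simp: admissible_def)
  qed
  then show ?thesis using card_mono[of "{fst (hd s)}"] by simp
qed

end

text \<open>The terms stem from stacks of height \<open>h + 1\<close>, from the push sum itself (one
  blocked index and rounding in each of \<open>r\<close> blocks), from raising the top letter, and
  from pops. At \<open>h = 0\<close> no pop occurs and the truncated \<open>h - 1\<close> only adds
  a non-negative term.\<close>

fun error_bound :: "nat \<Rightarrow> real \<Rightarrow> (nat \<Rightarrow> real) \<Rightarrow> real \<Rightarrow> nat \<Rightarrow> nat \<Rightarrow> real" where
  "error_bound r u M t 0 h = 0"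
| "error_bound r u M t (Suc m) h = error_bound r u M t m (Suc h) + (1 + real r) * t\<^sup>2 * (1 + u) ^ m
     + moment_bound M m (Suc h) * t + u * error_bound r u M t m (h - 1)"

lemma tendsto_error_bound:
  assumes "(f \<longlongrightarrow> 0) F"
  shows "((\<lambda>x. error_bound r u M (f x) m h) \<longlongrightarrow> 0) F"
proof (induction m arbitrary: h)
  case (Suc m)
  have "((\<lambda>x. error_bound r u M (f x) m (Suc h) + (1 + real r) * (f x)\<^sup>2 * (1 + u) ^ m
     + moment_bound M m (Suc h) * f x + u * error_bound r u M (f x) m (h - 1)) \<longlongrightarrow>
     0 + (1 + real r) * 0\<^sup>2 * (1 + u) ^ m + moment_bound M m (Suc h) * 0 + u * 0) F"
    by (intro tendsto_intros assms Suc.IH)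
  then show ?case by simp
qed simp

text \<open>Pushes are averaged by the probability vector \<open>d\<close> and a pop costs at most
  \<open>u\<close>, so each step contributes a factor of at most \<open>1 + u\<close>.\<close>

lemma abs_stack_weight_le:
  assumes "\<And>b. b < r \<Longrightarrow> 0 \<le> d b" "(\<Sum>b<r. d b) = 1" "0 \<le> u"
    and "\<And>a b. a < r \<Longrightarrow> b < r \<Longrightarrow> \<bar>U $$ (a, b)\<bar> \<le> u"
  shows "set bs \<subseteq> {..<r} \<Longrightarrow> \<bar>stack_weight r d U m bs\<bar> \<le> (1 + u) ^ m"
proof (induction m arbitrary: bs)
  case (Suc m)
  have "\<bar>\<Sum>b<r. d b * stack_weight r d U m (b # bs)\<bar> \<le> (\<Sum>b<r. d b * (1 + u) ^ m)"
    by (rule order_trans[OF sum_abs], rule sum_mono)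
       (use Suc assms(1) in \<open>auto simp: abs_mult intro!: mult_left_mono\<close>)
  also have "\<dots> = (1 + u) ^ m" using assms(2) by (simp add: sum_distrib_right[symmetric])
  finally have 1: "\<bar>\<Sum>b<r. d b * stack_weight r d U m (b # bs)\<bar> \<le> (1 + u) ^ m" .
  have 2: "\<bar>case bs of [] \<Rightarrow> 0 | b # bs' \<Rightarrow> U $$ (b, below b bs') * stack_weight r d U m bs'\<bar> \<le> u * (1 + u) ^ m"
  proof (cases bs)
    case (Cons b bs')
    then have b: "b < r" "below b bs' < r" "set bs' \<subseteq> {..<r}"
      using Suc.prems below_in[of b "{..<r}" bs'] by auto
    then show ?thesis
      using Cons Suc.IH[OF b(3)] assms(3) assms(4)[OF b(1,2)] by (auto simp: abs_mult intro!: mult_mono)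
  qed (use assms(3) in simp)
  show ?case using 1 2 by (simp add: distrib_right)
qed (use assms in simp)

section \<open>Comparison of scaled mixed moments with Dyck weights\<close>

locale block_array = scaled_array A I \<phi> \<psi> X e t M
  for A :: "'a star_algebra" (structure) and I :: "'i set" and \<phi> \<psi> X e t M +
  fixes r :: nat and d :: "nat \<Rightarrow> real" and U :: "real mat" and u :: real and block :: "'i \<Rightarrow> nat"
  assumes d_nonneg: "b < r \<Longrightarrow> 0 \<le> d b" and sum_d: "(\<Sum>b<r. d b) = 1"
    and u_nonneg: "0 \<le> u" and U_le: "a < r \<Longrightarrow> b < r \<Longrightarrow> \<bar>U $$ (a, b)\<bar> \<le> u"
    and block_less: "i \<in> I \<Longrightarrow> block i < r"
    and block_card: "b < r \<Longrightarrow> \<bar>t\<^sup>2 * real (card {i \<in> I. block i = b}) - d b\<bar> \<le> t\<^sup>2"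
    and variance: "i \<in> I \<Longrightarrow> j \<in> I \<Longrightarrow> moment i j 2 = complex_of_real (U $$ (block i, block j) * t\<^sup>2)"
begin

abbreviation "w \<equiv> stack_weight r d U"
abbreviation "N \<equiv> real (card I)"

lemma abs_w_le: "set bs \<subseteq> {..<r} \<Longrightarrow> \<bar>w m bs\<bar> \<le> (1 + u) ^ m"
  by (rule abs_stack_weight_le) (use d_nonneg sum_d u_nonneg U_le in auto)

text \<open>Three replacements: scaled moments by their limit weights, the allowed pushes by all of
  \<open>I\<close>, and block frequencies by \<open>d\<close>. They account for \<open>E\<close>,
  for the 1 and for the \<open>real r\<close> in the bound.\<close>

lemma push_error:
  assumes "admissible s" "set bs \<subseteq> {..<r}"
    and IH: "\<And>i. i \<in> pushable s \<Longrightarrow>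
      cmod (of_real (N ^ Suc h) * mixed_moment m ((i, Suc 0) # s) - of_real (w m (block i # bs))) \<le> E"
    and "0 \<le> E"
  shows "cmod (of_real (N ^ h) * (\<Sum>i\<in>pushable s. mixed_moment m ((i, Suc 0) # s)) -
      of_real (\<Sum>b<r. d b * w m (b # bs))) \<le> E + (1 + real r) * t\<^sup>2 * (1 + u) ^ m"
proof -
  let ?P = "pushable s" and ?f = "\<lambda>i. mixed_moment m ((i, Suc 0) # s)" and ?g = "\<lambda>i. w m (block i # bs)"
  let ?G = "(1 + u) ^ m"
  have P: "?P \<subseteq> I" by (auto simp: pushable_def)
  \<comment> \<open>The factor \<open>t\<^sup>2\<close> turns the sum over pushes into an average,
    so the error \<open>E\<close> of single terms does not accumulate.\<close>
  have Nh: "N ^ h = t\<^sup>2 * N ^ Suc h" using card_I by (simp add: mult_ac)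
  have g: "\<bar>?g i\<bar> \<le> ?G" if "i \<in> I" for i
    using abs_w_le[of "block i # bs" m] block_less[OF that] assms(2) by simp
  have "cmod (of_real (N ^ h) * (\<Sum>i\<in>?P. ?f i) - of_real (t\<^sup>2 * (\<Sum>i\<in>?P. ?g i))) =
      t\<^sup>2 * cmod (\<Sum>i\<in>?P. of_real (N ^ Suc h) * ?f i - of_real (?g i))"
  proof -
    have "of_real (N ^ h) * (\<Sum>i\<in>?P. ?f i) - of_real (t\<^sup>2 * (\<Sum>i\<in>?P. ?g i)) =
        of_real (t\<^sup>2) * (\<Sum>i\<in>?P. of_real (N ^ Suc h) * ?f i - of_real (?g i))"
      unfolding Nh by (simp only: of_real_mult of_real_sum sum_subtractf sum_distrib_left right_diff_distrib mult.assoc)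
    then show ?thesis by (simp add: norm_mult norm_power)
  qed
  also have "\<dots> \<le> t\<^sup>2 * (\<Sum>i\<in>?P. E)"
    by (intro mult_left_mono sum_norm_le IH) auto
  also have "\<dots> \<le> t\<^sup>2 * (N * E)"
    using P finite_I \<open>0 \<le> E\<close> by (intro mult_left_mono) (auto intro!: mult_right_mono card_mono)
  also have "\<dots> = E" using card_I by (simp add: mult_ac)
  finally have 1: "cmod (of_real (N ^ h) * (\<Sum>i\<in>?P. ?f i) - of_real (t\<^sup>2 * (\<Sum>i\<in>?P. ?g i))) \<le> E" .
  have "\<bar>\<Sum>i\<in>I - ?P. ?g i\<bar> \<le> (\<Sum>i\<in>I - ?P. ?G)"
    by (rule order_trans[OF sum_abs], rule sum_mono) (use g in auto)
  also have "\<dots> = real (card (I - ?P)) * ?G" by simp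
  also have "\<dots> \<le> 1 * ?G"
    using card_not_pushable[OF assms(1)] u_nonneg by (intro mult_right_mono) auto
  finally have "\<bar>\<Sum>i\<in>I - ?P. ?g i\<bar> \<le> ?G" by simp
  moreover have "(\<Sum>i\<in>I. ?g i) = (\<Sum>i\<in>I - ?P. ?g i) + (\<Sum>i\<in>?P. ?g i)"
    by (rule sum.subset_diff[OF P finite_I])
  ultimately have "\<bar>(\<Sum>i\<in>?P. ?g i) - (\<Sum>i\<in>I. ?g i)\<bar> \<le> ?G" by simp
  then have 2: "\<bar>t\<^sup>2 * (\<Sum>i\<in>?P. ?g i) - t\<^sup>2 * (\<Sum>i\<in>I. ?g i)\<bar> \<le> t\<^sup>2 * ?G"
    by (simp add: right_diff_distrib[symmetric] abs_mult mult_left_mono)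
  have "t\<^sup>2 * (\<Sum>i\<in>I. ?g i) = t\<^sup>2 * (\<Sum>b<r. \<Sum>i\<in>{i \<in> I. block i = b}. ?g i)"
    by (subst sum.group) (use finite_I block_less in auto)
  also have "\<dots> = (\<Sum>b<r. t\<^sup>2 * real (card {i \<in> I. block i = b}) * w m (b # bs))"
    by (simp add: sum_distrib_left mult_ac)
  finally have "t\<^sup>2 * (\<Sum>i\<in>I. ?g i) - (\<Sum>b<r. d b * w m (b # bs)) =
      (\<Sum>b<r. (t\<^sup>2 * real (card {i \<in> I. block i = b}) - d b) * w m (b # bs))"
    by (simp add: sum_subtractf left_diff_distrib)
  also have "\<bar>\<dots>\<bar> \<le> (\<Sum>b<r. t\<^sup>2 * ?G)"
    by (rule order_trans[OF sum_abs], rule sum_mono)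
       (use block_card abs_w_le assms(2) in \<open>auto simp: abs_mult intro!: mult_mono\<close>)
  finally have 3: "\<bar>t\<^sup>2 * (\<Sum>i\<in>I. ?g i) - (\<Sum>b<r. d b * w m (b # bs))\<bar> \<le> real r * t\<^sup>2 * ?G" by simp
  have "\<bar>t\<^sup>2 * (\<Sum>i\<in>?P. ?g i) - (\<Sum>b<r. d b * w m (b # bs))\<bar> \<le> (1 + real r) * t\<^sup>2 * ?G"
    using 2 3 by (simp add: distrib_right)
  then have "cmod (of_real (t\<^sup>2 * (\<Sum>i\<in>?P. ?g i)) - of_real (\<Sum>b<r. d b * w m (b # bs)))
      \<le> (1 + real r) * t\<^sup>2 * ?G"
    by (simp only: of_real_diff[symmetric] norm_of_real)
  from norm_triangle_mono[OF 1 this] show ?thesis by simp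
qed

lemma error_bound_nonneg: "0 \<le> error_bound r u M t m h"
proof (induction m arbitrary: h)
  case (Suc m)
  then show ?case
    using u_nonneg t_pos moment_bound_nonneg[of M, OF M_nonneg]
    by (auto intro!: add_nonneg_nonneg mult_nonneg_nonneg)
qed simp

text \<open>Stacks of first powers suffice: pushes and pops stay among them, resets vanish with the
  first moments, and a raised top letter is negligible by
  \<open>norm_mixed_moment_le\<close>.\<close>

lemma mixed_moment_error:
  assumes "admissible (map (\<lambda>i. (i, Suc 0)) is)"
  shows "cmod (of_real (N ^ length is) * mixed_moment m (map (\<lambda>i. (i, Suc 0)) is)
    - of_real (w m (map block is))) \<le> error_bound r u M t m (length is)"
  using assms
proof (induction m arbitrary: "is")
  case 0
  then show ?case by (simp add: mixed_moment_0)
next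
  case (Suc m)
  let ?s = "\<lambda>is. map (\<lambda>i. (i, Suc 0)) is" and ?h = "length is" and ?E = "error_bound r u M t"
  have "set is \<subseteq> I" using Suc.prems by (auto simp: admissible_def)
  then have bs: "set (map block is) \<subseteq> {..<r}" using block_less by auto
  have push: "cmod (of_real (N ^ ?h) * (\<Sum>i\<in>pushable (?s is). mixed_moment m ((i, Suc 0) # ?s is)) -
      of_real (\<Sum>b<r. d b * w m (b # map block is))) \<le> ?E m (Suc ?h) + (1 + real r) * t\<^sup>2 * (1 + u) ^ m"
  proof (rule push_error[OF Suc.prems bs _ error_bound_nonneg])
    fix i assume "i \<in> pushable (?s is)"
    then have "admissible (?s (i # is))" by (simp add: pushable_def)
    from Suc.IH[OF this] show "cmod (of_real (N ^ Suc ?h) * mixed_moment m ((i, Suc 0) # ?s is)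
        - of_real (w m (block i # map block is))) \<le> ?E m (Suc ?h)"
      by simp
  qed
  show ?case
  proof (cases "is")
    case Nil
    have "0 \<le> moment_bound M m (Suc 0) * t" "0 \<le> u * ?E m 0"
      using moment_bound_nonneg[of M, OF M_nonneg] t_pos u_nonneg error_bound_nonneg by auto
    then show ?thesis using push Nil mixed_moment_Suc[OF Suc.prems] by simp
  next
    case (Cons i js)
    let ?j = "below i js"
    have s: "admissible ((i, Suc 0) # ?s js)" using Suc.prems Cons by simp
    then have i: "i \<in> I" "admissible (?s js)" and s2: "admissible ((i, Suc (Suc 0)) # ?s js)"
      by (auto simp: admissible_Cons)
    have comp: "map fst (?s js) = js" by (induction js) auto
    then have j: "?j \<in> I" using admissible_below[OF i(2,1)] by simp
    let ?b = "mixed_moment m ((i, Suc (Suc 0)) # ?s js)"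
    let ?u = "U $$ (block i, block ?j)"
    \<comment> \<open>After the raise the height is \<open>?h\<close> and the level
      \<open>?h + 1\<close>; the scaling removes all but one power of \<open>t\<close>.\<close>
    have "cmod (of_real (N ^ ?h) * ?b) \<le> N ^ ?h * (moment_bound M m (Suc ?h) * t ^ (2 * ?h + 1))"
    proof -
      have "level (?s js) = length js" by (induction js) auto
      then have "cmod ?b \<le> moment_bound M m (Suc ?h) * t ^ (2 * ?h + 1)"
        using norm_mixed_moment_le[OF s2, of m] Cons by (simp add: mult_2)
      then show ?thesis by (simp add: norm_mult norm_power mult_left_mono)
    qed
    also have "\<dots> = (N * t\<^sup>2) ^ ?h * (moment_bound M m (Suc ?h) * t)"
      by (simp add: power_mult_distrib power_mult[symmetric] mult_ac)
    finally have 1: "cmod (of_real (N ^ ?h) * ?b) \<le> moment_bound M m (Suc ?h) * t"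
      using card_I by simp
    \<comment> \<open>One factor \<open>N\<close> cancels the \<open>t\<^sup>2\<close> of the
      variance, which leaves the scaling of the shorter stack.\<close>
    have pop: "of_real (N ^ ?h) * (moment i ?j (Suc (Suc 0)) * mixed_moment m (?s js)) =
        of_real ?u * (of_real (N ^ length js) * mixed_moment m (?s js))"
    proof -
      have "of_real (N ^ ?h) * moment i ?j (Suc (Suc 0)) = of_real ((N * t\<^sup>2) * N ^ length js * ?u)"
        using variance[OF i(1) j] Cons by (simp add: numeral_2_eq_2 mult_ac)
      then show ?thesis using card_I by (simp add: mult_ac)
    qed
    have "cmod (of_real ?u * (of_real (N ^ length js) * mixed_moment m (?s js)) -
        of_real (?u * w m (map block js))) =
        \<bar>?u\<bar> * cmod (of_real (N ^ length js) * mixed_moment m (?s js) - of_real (w m (map block js)))"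
      by (simp add: right_diff_distrib[symmetric] norm_mult)
    also have "\<dots> \<le> u * ?E m (length js)"
      using U_le block_less i(1) j u_nonneg by (intro mult_mono Suc.IH i(2)) auto
    finally have 2: "cmod (of_real ?u * (of_real (N ^ length js) * mixed_moment m (?s js)) -
        of_real (?u * w m (map block js))) \<le> u * ?E m (length js)" .
    have "of_real (N ^ ?h) * mixed_moment (Suc m) (?s is) - of_real (w (Suc m) (map block is)) =
      (of_real (N ^ ?h) * (\<Sum>i\<in>pushable (?s is). mixed_moment m ((i, Suc 0) # ?s is)) -
         of_real (\<Sum>b<r. d b * w m (b # map block is))) +
      of_real (N ^ ?h) * ?b +
      (of_real ?u * (of_real (N ^ length js) * mixed_moment m (?s js)) - of_real (?u * w m (map block js)))"
      using mixed_moment_Suc[OF Suc.prems, of m] moment_1[OF i(1) j] comp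
      unfolding pop[symmetric]
      by (simp add: Cons below_map algebra_simps del: of_real_sum of_real_power)
    also have "cmod \<dots> \<le> (?E m (Suc ?h) + (1 + real r) * t\<^sup>2 * (1 + u) ^ m) +
        moment_bound M m (Suc ?h) * t + u * ?E m (length js)"
      by (intro norm_triangle_le add_mono push 1 2)
    finally show ?thesis using Cons by simp
  qed
qed

lemma moment_total_error:
  "cmod (\<phi> (total [^] m) - of_real (w m [])) \<le> error_bound r u M t m 0"
  using mixed_moment_error[of "[]" m] total_closed by (simp add: mixed_moment_def word_simps)

end

section \<open>Sizes of the blocks\<close>

context
  fixes r :: nat and d :: "nat \<Rightarrow> real"
  assumes d_pos: "\<And>b. b < r \<Longrightarrow> 0 < d b" and sum_d: "(\<Sum>b<r. d b) = 1"
begin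

definition block_end :: "nat \<Rightarrow> nat \<Rightarrow> nat" where
  "block_end n b = nat \<lfloor>(\<Sum>l<b. d l) * real n\<rfloor>"

definition block_index :: "nat \<Rightarrow> nat \<Rightarrow> nat" where
  "block_index n i = (LEAST b. i \<le> block_end n (Suc b))"

lemma block_interval_eq: "block_interval d n b = {block_end n b<..block_end n (Suc b)}"
  by (simp add: block_interval_def block_end_def)

lemma block_end_mono: "b \<le> c \<Longrightarrow> c \<le> r \<Longrightarrow> block_end n b \<le> block_end n c"
  unfolding block_end_def using d_pos
  by (intro nat_mono floor_mono mult_right_mono sum_mono2) (auto simp: less_imp_le)

lemma block_end_0: "block_end n 0 = 0" and block_end_r: "block_end n r = n"
  by (simp_all add: block_end_def sum_d)

text \<open>The last block ends at \<open>n\<close> since the \<open>d b\<close> sum to 1, so some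
  block end reaches \<open>i\<close>; minimality puts the preceding end below
  \<open>i\<close>.\<close>

lemma block_index_props:
  assumes "i \<in> {1..n}"
  shows "block_index n i < r" "i \<in> block_interval d n (block_index n i)"
proof -
  have "r \<noteq> 0" using sum_d by (cases r) auto
  then have "i \<le> block_end n (Suc (r - 1))" using assms block_end_r by simp
  then have "block_index n i \<le> r - 1" unfolding block_index_def by (rule Least_le)
  then show "block_index n i < r" using \<open>r \<noteq> 0\<close> by simp
  have "i \<le> block_end n (Suc (block_index n i))"
    unfolding block_index_def by (rule LeastI) fact
  moreover have "block_end n (block_index n i) < i"
  proof (cases "block_index n i")
    case 0
    then show ?thesis using assms by (simp add: block_end_0)
  next
    case (Suc b)
    then have "\<not> i \<le> block_end n (Suc b)"
      using not_less_Least[of b "\<lambda>b. i \<le> block_end n (Suc b)"] by (simp add: block_index_def)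
    then show ?thesis using Suc by simp
  qed
  ultimately show "i \<in> block_interval d n (block_index n i)" by (simp add: block_interval_eq)
qed

lemma block_index_fibre:
  assumes "b < r"
  shows "{i \<in> {1..n}. block_index n i = b} = block_interval d n b"
proof
  show "{i \<in> {1..n}. block_index n i = b} \<subseteq> block_interval d n b"
    using block_index_props(2) by blast
  show "block_interval d n b \<subseteq> {i \<in> {1..n}. block_index n i = b}"
  proof
    fix i assume "i \<in> block_interval d n b"
    then have i: "block_end n b < i" "i \<le> block_end n (Suc b)" by (auto simp: block_interval_eq)
    have "b \<le> c" if "i \<le> block_end n (Suc c)" for c
    proof (rule ccontr)
      assume "\<not> b \<le> c"
      then have "block_end n (Suc c) \<le> block_end n b" using assms by (intro block_end_mono) auto
      then show False using i that by simp
    qed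
    then have "block_index n i = b" unfolding block_index_def using i(2) by (intro Least_equality)
    moreover have "i \<le> n" using i(2) block_end_mono[of "Suc b" r n] assms block_end_r by simp
    ultimately show "i \<in> {i \<in> {1..n}. block_index n i = b}" using i(1) by simp
  qed
qed

text \<open>A block size is a difference of two floors, each less than 1 below its argument, so the
  rounding errors differ by less than 1.\<close>

lemma card_block:
  assumes "b < r"
  shows "\<bar>real (card {i \<in> {1..n}. block_index n i = b}) - d b * real n\<bar> \<le> 1"
proof -
  let ?s = "\<lambda>b. (\<Sum>l<b. d l) * real n"
  have nn: "0 \<le> ?s c" if "c \<le> r" for c
    using d_pos that by (intro mult_nonneg_nonneg sum_nonneg) (auto simp: less_imp_le)
  have "real (card {i \<in> {1..n}. block_index n i = b}) = real (block_end n (Suc b)) - real (block_end n b)"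
    unfolding block_index_fibre[OF assms] block_interval_eq card_greaterThanAtMost
    by (rule of_nat_diff, rule block_end_mono) (use assms in auto)
  also have "\<dots> = of_int \<lfloor>?s (Suc b)\<rfloor> - of_int \<lfloor>?s b\<rfloor>"
    using nn[of b] nn[of "Suc b"] assms by (simp add: block_end_def)
  finally have *: "real (card {i \<in> {1..n}. block_index n i = b}) = of_int \<lfloor>?s (Suc b)\<rfloor> - of_int \<lfloor>?s b\<rfloor>" .
  have "?s (Suc b) = ?s b + d b * real n" by (simp add: distrib_right)
  then show ?thesis
    unfolding * using of_int_floor_le[of "?s b"] of_int_floor_le[of "?s (Suc b)"]
      real_of_int_floor_add_one_gt[of "?s b"] real_of_int_floor_add_one_gt[of "?s (Suc b)"]
    by linarith
qed

end

section \<open>Passage to the limit\<close>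

theorem theorem6p2:
  fixes A :: "nat \<Rightarrow> 'a star_algebra"
    and \<phi> :: "nat \<Rightarrow> 'a \<Rightarrow> complex"
    and \<psi> :: "nat \<Rightarrow> nat \<Rightarrow> 'a \<Rightarrow> complex"
    and X :: "nat \<Rightarrow> nat \<Rightarrow> nat \<Rightarrow> 'a"
    and v :: "nat \<Rightarrow> nat \<Rightarrow> nat \<Rightarrow> real"
    and r :: nat and d :: "nat \<Rightarrow> real" and U :: "real mat" and m :: nat
  assumes "\<And>n. n \<ge> 1 \<Longrightarrow> unital_star_algebra (A n)"
    and "\<And>n. n \<ge> 1 \<Longrightarrow> state (A n) (\<phi> n)"
    and "\<And>n j. n \<ge> 1 \<Longrightarrow> j \<in> {1..n} \<Longrightarrow> state (A n) (\<psi> n j)"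
    and "\<And>n i j. n \<ge> 1 \<Longrightarrow> i \<in> {1..n} \<Longrightarrow> j \<in> {1..n} \<Longrightarrow> self_adjoint (A n) (X n i j)"
    and "\<And>n. n \<ge> 1 \<Longrightarrow> matricially_free_variables (A n) {1..n} (\<phi> n) (\<psi> n) (X n)"
    and "\<And>n i j. n \<ge> 1 \<Longrightarrow> i \<in> {1..n} \<Longrightarrow> j \<in> {1..n} \<Longrightarrow>
           state_array (\<phi> n) (\<psi> n) i j (X n i j) = 0"
    and "\<And>n i j. n \<ge> 1 \<Longrightarrow> i \<in> {1..n} \<Longrightarrow> j \<in> {1..n} \<Longrightarrow>
           state_array (\<phi> n) (\<psi> n) i j (X n i j [^]\<^bsub>A n\<^esub> (2::nat)) = complex_of_real (v n i j)"
    and "\<And>k::nat. \<exists>M\<ge>0. \<forall>n\<ge>1. \<forall>i\<in>{1..n}. \<forall>j\<in>{1..n}.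
           cmod (state_array (\<phi> n) (\<psi> n) i j (X n i j [^]\<^bsub>A n\<^esub> k)) \<le> M * real n powr (- real k / 2)"
    and "\<And>k. k < r \<Longrightarrow> d k > 0"
    and "(\<Sum>k<r. d k) = 1"
    and "U \<in> carrier_mat r r"
    and "\<And>i. i < r \<Longrightarrow> U $$ (i, i) > 0"
    and "\<And>i j. i < r \<Longrightarrow> j < r \<Longrightarrow> i \<noteq> j \<Longrightarrow> U $$ (i, j) \<ge> 0"
    and "\<And>n. n \<ge> 1 \<Longrightarrow> block_form r d U n (v n)"
  shows "(\<lambda>n. \<phi> n (finsum (A n) (\<lambda>(i, j). X n i j) ({1..n} \<times> {1..n}) [^]\<^bsub>A n\<^esub> m))
           \<longlonglongrightarrow> complex_of_real (\<Sum>\<pi>\<in>NC2 {1..m}. v0 (mat_diag r d * U) \<pi>)"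
proof -
  let ?free = "\<lambda>n e. n \<ge> 1 \<longrightarrow> matricially_free (A n) {1..n} (\<phi> n) (\<psi> n)
      (\<lambda>i j. nonunital_subalgebra (A n) hull {X n i j, e i j}) e"
  have "\<forall>n. \<exists>e. ?free n e"
    using assms(5) unfolding matricially_free_variables_def by blast
  from choice[OF this] obtain e where "\<forall>n. ?free n (e n)" ..
  then have free: "\<And>n. n \<ge> 1 \<Longrightarrow> matricially_free (A n) {1..n} (\<phi> n) (\<psi> n)
      (\<lambda>i j. nonunital_subalgebra (A n) hull {X n i j, e n i j}) (e n)"
    by simp
  let ?bound = "\<lambda>k M. 0 \<le> M \<and> (\<forall>n\<ge>1. \<forall>i\<in>{1..n}. \<forall>j\<in>{1..n}.
      cmod (state_array (\<phi> n) (\<psi> n) i j (X n i j [^]\<^bsub>A n\<^esub> k)) \<le> M * real n powr (- real k / 2))"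
  have "\<forall>k. \<exists>M. ?bound k M" using assms(8) by blast
  from choice[OF this] obtain M where "\<forall>k. ?bound k (M k)" ..
  then have M: "0 \<le> M k" "n \<ge> 1 \<Longrightarrow> i \<in> {1..n} \<Longrightarrow> j \<in> {1..n} \<Longrightarrow>
      cmod (state_array (\<phi> n) (\<psi> n) i j (X n i j [^]\<^bsub>A n\<^esub> k)) \<le> M k * real n powr (- real k / 2)"
    for k n i j by blast+
  \<comment> \<open>Any common bound for the entries of \<open>U\<close> serves; the sum of all
    absolute values is one.\<close>
  define u where "u = (\<Sum>p\<in>{..<r} \<times> {..<r}. \<bar>U $$ p\<bar>)"
  have u: "\<bar>U $$ (a, b)\<bar> \<le> u" if "a < r" "b < r" for a b
    unfolding u_def using that by (intro member_le_sum) auto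
  have error: "cmod (\<phi> n (finsum (A n) (\<lambda>(i, j). X n i j) ({1..n} \<times> {1..n}) [^]\<^bsub>A n\<^esub> m) -
      of_real (stack_weight r d U m [])) \<le> error_bound r u M (1 / sqrt (real n)) m 0"
    if n: "n \<ge> 1" for n
  proof -
    let ?t = "1 / sqrt (real n)"
    have t2: "?t\<^sup>2 = 1 / real n" by (simp add: power_divide)
    \<comment> \<open>This brings the uniform boundedness into the form required by
      \<open>scaled_array\<close>.\<close>
    have powr: "real n powr (- real k / 2) = ?t ^ k" for k
    proof -
      have "?t = real n powr (- (1 / 2))"
        unfolding powr_minus powr_half_sqrt[OF of_nat_0_le_iff] by (simp add: divide_inverse)
      then have "?t ^ k = real n powr (real k * - (1 / 2))"
        using n by (simp only: powr_power)
      then show ?thesis by simp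
    qed
    interpret matricially_free_array "A n" "{1..n}" "\<phi> n" "\<psi> n" "X n" "e n"
      by (intro matricially_free_array.intro matricially_free_array_axioms.intro assms(1,6) free)
         (use n assms(4)[OF n] in \<open>auto simp: self_adjoint_def\<close>)
    interpret scaled_array "A n" "{1..n}" "\<phi> n" "\<psi> n" "X n" "e n" ?t M
    proof
      show "real (card {1..n}) * ?t\<^sup>2 = 1" unfolding t2 using n by simp
      show "cmod (moment i j k) \<le> M k * ?t ^ k" if "i \<in> {1..n}" "j \<in> {1..n}" for i j k
        using M(2)[OF n that, of k] unfolding powr moment_def .
    qed (use n M(1) in auto)
    interpret block_array "A n" "{1..n}" "\<phi> n" "\<psi> n" "X n" "e n" ?t M r d U u "block_index d n"
    proof
      show "\<bar>?t\<^sup>2 * real (card {i \<in> {1..n}. block_index d n i = b}) - d b\<bar> \<le> ?t\<^sup>2" if "b < r" for b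
      proof -
        have "\<bar>real (card {i \<in> {1..n}. block_index d n i = b}) - d b * real n\<bar> / real n \<le> 1 / real n"
          by (intro divide_right_mono card_block[of r d] assms(9,10) that) auto
        also have "\<bar>real (card {i \<in> {1..n}. block_index d n i = b}) - d b * real n\<bar> / real n =
            \<bar>(real (card {i \<in> {1..n}. block_index d n i = b}) - d b * real n) / real n\<bar>"
          by simp
        also have "(real (card {i \<in> {1..n}. block_index d n i = b}) - d b * real n) / real n =
            1 / real n * real (card {i \<in> {1..n}. block_index d n i = b}) - d b"
          using n by (simp add: diff_divide_distrib)
        finally show ?thesis unfolding t2 .
      qed
      show "block_index d n i < r" if "i \<in> {1..n}" for i
        by (rule block_index_props[of r d]) (use assms(9,10) that in auto)
      show "moment i j 2 = complex_of_real (U $$ (block_index d n i, block_index d n j) * ?t\<^sup>2)"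
        if "i \<in> {1..n}" "j \<in> {1..n}" for i j
      proof -
        have "block_index d n k < r \<and> k \<in> block_interval d n (block_index d n k)" if "k \<in> {1..n}" for k
          using block_index_props[of r d, OF assms(9,10) that] by blast
        then have "v n i j = U $$ (block_index d n i, block_index d n j) / real n"
          using assms(14)[OF n] that unfolding block_form_def by blast
        then show ?thesis using assms(7)[OF n that] unfolding moment_def t2 by simp
      qed
      show "0 \<le> u" unfolding u_def by (simp add: sum_nonneg)
    qed (use assms(9,10) u in \<open>auto simp: less_imp_le\<close>)
    show ?thesis using moment_total_error[of m] by (simp only: total_def)
  qed
  have "(\<lambda>n. 1 / sqrt (real n)) \<longlonglongrightarrow> 0" 
    by (intro tendsto_divide_0[OF tendsto_const] filterlim_at_top_imp_at_infinity
        filterlim_compose[OF sqrt_at_top filterlim_real_sequentially])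
  then have "(\<lambda>n. error_bound r u M (1 / sqrt (real n)) m 0) \<longlonglongrightarrow> 0" by (rule tendsto_error_bound)
  moreover have "\<forall>\<^sub>F n in sequentially.
      cmod (\<phi> n (finsum (A n) (\<lambda>(i, j). X n i j) ({1..n} \<times> {1..n}) [^]\<^bsub>A n\<^esub> m) -
        of_real (stack_weight r d U m [])) \<le> error_bound r u M (1 / sqrt (real n)) m 0"
    using eventually_ge_at_top[of 1] by eventually_elim (rule error)
  ultimately have "(\<lambda>n. \<phi> n (finsum (A n) (\<lambda>(i, j). X n i j) ({1..n} \<times> {1..n}) [^]\<^bsub>A n\<^esub> m) -
      of_real (stack_weight r d U m [])) \<longlonglongrightarrow> 0"
    by (rule Lim_null_comparison[rotated])
  \<comment> \<open>The free starting point is taken to be 1, which makes the interval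
    \<open>{1..m}\<close>.\<close>
  moreover have "stack_weight r d U m [] = (\<Sum>\<pi>\<in>NC2 {1..m}. v0 (mat_diag r d * U) \<pi>)"
    using stack_weight_Nil[OF assms(11), of d m 1] by (simp add: atLeastLessThanSuc_atLeastAtMost)
  ultimately show ?thesis by (simp only: LIM_zero_iff)
qed

end
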